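(* Let $\delta\ge 0$, let $P$ be a time series of complexity $n$, and let $P'=\langle P(i_1),\dots,P(i_{s_P})\rangle$ be a $\delta$-signature of $P$. Let $r_1=B(P(1),3\delta)$, $r_{s_P}=B(P(i_{s_P}),3\delta)$ and $r_k=B(P(i_k),\delta)$ for $k=2,\dots,s_P-1$. Let $Q$ and $\widehat Q$ be time series such that $d_F(P,Q)\le\delta$ and $\widehat Q$ is obtained from $Q$ by removing some vertex $Q(j')$ with $Q(j')\notin\bigcup_{1\le k\le s_P}r_k$. Then $d_F(P,\widehat Q)\le\delta$.
   Context: **Time series.** A time series $P=\langle P(1),\dots,P(n)\rangle$ of complexity $n$ is given by reals $P(1),\dots,P(n)$ (its vertices) and is viewed as the piecewise linear function $P:[1,n]\to\mathbb{R}$, $P(i+\alpha)=(1-\alpha)P(i)+\alpha P(i+1)$ for $\alpha\in[0,1]$. $P[s_1,s_2]$ is the subcurve from $P(s_1)$ to $P(s_2)$. $\overline{xy}$ is the segment between reals $x,y$, and $B(X,r)$ is the set of reals at distance at most $r$ from some point of $X$ (so $B(x,r)=[x-r,x+r]$ for a real $x$). A curve is $\varepsilon$-monotone increasing (resp. decreasing) if $P(s)\le P(s')+\varepsilon$ (resp. $P(s)\ge P(s')-\varepsilon$) for all $s<s'$. **Fréchet distance.** $d_F(P,Q)=\min_{h_P,h_Q}\max_{a\in[0,1]}|P(h_P(a))-Q(h_Q(a))|$, over continuous non-decreasing $h_P:[0,1]\to[1,n]$, $h_Q:[0,1]\to[1,m]$ with $h_P(0)=h_Q(0)=1$, $h_P(1)=n$,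 $h_Q(1)=m$. **$\delta$-signature.** A $\delta$-signature of $P$ is a time series $P'=\langle P(i_1),\dots,P(i_t)\rangle$ with $1=i_1<\dots<i_t=n$ such that: (a) $P(i_k)\notin\overline{P(i_{k-1})P(i_{k+1})}$ for $k=2,\dots,t-1$; (b) for $k=1,\dots,t-1$, $P[i_k,i_{k+1}]$ is $2\delta$-monotone increasing or decreasing; (c) if $t>2$, then $|P(i_k)-P(i_{k+1})|>2\delta$ for $k=2,\dots,t-2$, $|P(i_1)-P(i_2)|>\delta$ and $|P(i_{t-1})-P(i_t)|>\delta$; (d) for $k=2,\dots,t-2$, $P(s)\in\overline{P(i_k)P(i_{k+1})}$ for all $s\in[i_k,i_{k+1}]$; if $t>2$, $P(s)\in B(P(1),\delta)\cup\overline{P(1)P(i_2)}$ for $s\in[1,i_2]$ and $P(s)\in B(P(n),\delta)\cup\overline{P(i_{t-1})P(n)}$ for $s\in[i_{t-1},n]$; if $t=2$, $P(s)\in B(\overline{P(1)P(n)},\delta)$ for all $s\in[1,n]$. *)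

theory Defs
  imports "HOL-Analysis.Analysis"
begin

text \<open>
  A time series of complexity \<open>n \<ge> 1\<close> is a nonempty list of \<open>n\<close> reals; vertices are
  indexed from 1.
\<close>

definition vertex :: "real list \<Rightarrow> nat \<Rightarrow> real" where
  "vertex P i = P ! (i - 1)"

text \<open>
  The piecewise linear function on \<open>[1, n]\<close>. At \<open>s = n\<close> the value \<open>vertex P (n + 1)\<close> is
  unspecified, but it is multiplied by \<open>frac s = 0\<close>. Values outside \<open>[1, n]\<close>
  are meaningless and are never used.
\<close>

definition curve :: "real list \<Rightarrow> real \<Rightarrow> real" where
  "curve P s = (1 - frac s) * vertex P (nat \<lfloor>s\<rfloor>) + frac s * vertex P (nat \<lfloor>s\<rfloor> + 1)"

definition remove_vertex :: "nat \<Rightarrow> real list \<Rightarrow> real list" where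
  "remove_vertex j Q = take (j - 1) Q @ drop j Q"

definition nbhd :: "real set \<Rightarrow> real \<Rightarrow> real set" where
  "nbhd X r = (\<Union>x\<in>X. cball x r)"

definition eps_mono_increasing :: "real \<Rightarrow> (real \<Rightarrow> real) \<Rightarrow> real set \<Rightarrow> bool" where
  "eps_mono_increasing \<epsilon> f I \<longleftrightarrow> (\<forall>s\<in>I. \<forall>s'\<in>I. s < s' \<longrightarrow> f s \<le> f s' + \<epsilon>)"

definition eps_mono_decreasing :: "real \<Rightarrow> (real \<Rightarrow> real) \<Rightarrow> real set \<Rightarrow> bool" where
  "eps_mono_decreasing \<epsilon> f I \<longleftrightarrow> (\<forall>s\<in>I. \<forall>s'\<in>I. s < s' \<longrightarrow> f s \<ge> f s' - \<epsilon>)"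

definition reparametrization :: "nat \<Rightarrow> (real \<Rightarrow> real) \<Rightarrow> bool" where
  "reparametrization n h \<longleftrightarrow>
     h \<in> {0..1} \<rightarrow> {1..real n} \<and> continuous_on {0..1} h \<and> mono_on {0..1} h \<and>
     h 0 = 1 \<and> h 1 = real n"

text \<open>
  The outer minimum over pairs of reparametrizations is written as an infimum and the inner
  maximum, which is over a continuous function on a compact interval, as a supremum. For
  nonempty \<open>P\<close> and \<open>Q\<close> the infimum is over a nonempty set of nonnegative reals.
\<close>

definition frechet_dist :: "real list \<Rightarrow> real list \<Rightarrow> real" where
  "frechet_dist P Q =
     Inf {(SUP a\<in>{0..1}. \<bar>curve P (h a) - curve Q (g a)\<bar>) | h g.
            reparametrization (length P) h \<and> reparametrization (length Q) g}"

text \<open>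
  \<open>P'\<close> is the \<open>\<delta>\<close>-signature of \<open>P\<close> at the indices \<open>i 1 < \<dots> < i t\<close>, where \<open>t = length P'\<close>;
  values of \<open>i\<close> outside \<open>{1..t}\<close> are irrelevant.
\<close>

definition is_signature :: "real \<Rightarrow> real list \<Rightarrow> (nat \<Rightarrow> nat) \<Rightarrow> real list \<Rightarrow> bool" where
  "is_signature \<delta> P i P' \<longleftrightarrow>
    (let t = length P'; n = length P in
      t \<ge> 1 \<and> i 1 = 1 \<and> i t = n \<and> strict_mono_on {1..t} i \<and>
      (\<forall>k\<in>{1..t}. vertex P' k = vertex P (i k)) \<and>
      (\<forall>k\<in>{2..t - 1}.
         vertex P (i k) \<notin> closed_segment (vertex P (i (k - 1))) (vertex P (i (k + 1)))) \<and>
      (\<forall>k\<in>{1..t - 1}.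
         eps_mono_increasing (2 * \<delta>) (curve P) {real (i k)..real (i (k + 1))} \<or>
         eps_mono_decreasing (2 * \<delta>) (curve P) {real (i k)..real (i (k + 1))}) \<and>
      (t > 2 \<longrightarrow>
         (\<forall>k\<in>{2..t - 2}. \<bar>vertex P (i k) - vertex P (i (k + 1))\<bar> > 2 * \<delta>) \<and>
         \<bar>vertex P (i 1) - vertex P (i 2)\<bar> > \<delta> \<and>
         \<bar>vertex P (i (t - 1)) - vertex P (i t)\<bar> > \<delta>) \<and>
      (\<forall>k\<in>{2..t - 2}. \<forall>s\<in>{real (i k)..real (i (k + 1))}.
         curve P s \<in> closed_segment (vertex P (i k)) (vertex P (i (k + 1)))) \<and>
      (t > 2 \<longrightarrow>
         (\<forall>s\<in>{1..real (i 2)}.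
            curve P s \<in> cball (vertex P 1) \<delta> \<union>
              closed_segment (vertex P 1) (vertex P (i 2))) \<and>
         (\<forall>s\<in>{real (i (t - 1))..real n}.
            curve P s \<in> cball (vertex P n) \<delta> \<union>
              closed_segment (vertex P (i (t - 1))) (vertex P n))) \<and>
      (t = 2 \<longrightarrow>
         (\<forall>s\<in>{1..real n}.
            curve P s \<in> nbhd (closed_segment (vertex P 1) (vertex P n)) \<delta>)))"

end

theory Submission
  imports Defs
begin

text \<open>
  The claim is tested against every \<open>D\<close> slightly above \<open>\<delta>\<close>: the finitely many strict inequalities of the
  signature persist with \<open>D\<close> in place of \<open>\<delta>\<close>, and a matching of width \<open>D\<close> exists although the infimum in
  the Frechet distance need not be known to be attained.

  The removed vertex only matters if it is a local extremum, say a peak of height \<open>w\<close>; removing it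
  amounts to cutting the peak at the height \<open>z\<close> of the higher neighbour. As \<open>w\<close> is far from the signature
  vertices, the point of \<open>P\<close> matched with the peak lies on a signature edge that passes beyond
  \<open>w + D\<close>, and by time reversal this edge increases. If \<open>P\<close> has a maximum \<open>M > z + D\<close> opposite the peak,
  then \<open>P\<close> stays above \<open>M - 2D\<close> until \<open>Q\<close> climbs back to \<open>M - D\<close>, so the cut curve may wait at \<open>M - D\<close>
  during all that time, and it gets there by performing its whole motion opposite a single low point
  of \<open>P\<close>. Such a low point exists because of what precedes the edge; if it lies opposite the peak
  itself, the argument is repeated for the part of \<open>P\<close> before it. This ends, since \<open>P\<close> rises by \<open>2D\<close> in
  each round.
\<close>

section \<open>Matchings of pieces of curves\<close>

text \<open>In contrast to \<open>reparametrization\<close>, the range is an arbitrary interval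
  \<open>[a, b]\<close>, possibly a single point, so that waiting is a path too and matchings can be
  cut into pieces.\<close>

definition monotone_path :: "real \<Rightarrow> real \<Rightarrow> (real \<Rightarrow> real) \<Rightarrow> bool" where
  "monotone_path a b h \<longleftrightarrow> continuous_on {0..1} h \<and> mono_on {0..1} h \<and> h 0 = a \<and> h 1 = b"

definition frechet_le ::
    "real \<Rightarrow> (real \<Rightarrow> real) \<Rightarrow> real \<Rightarrow> real \<Rightarrow> (real \<Rightarrow> real) \<Rightarrow> real \<Rightarrow> real \<Rightarrow> bool" where
  "frechet_le D f a b g c d \<longleftrightarrow>
     (\<exists>h k. monotone_path a b h \<and> monotone_path c d k \<and> (\<forall>t\<in>{0..1}. \<bar>f (h t) - g (k t)\<bar> \<le> D))"

section \<open>Symmetries, joining and splitting of matchings\<close>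

lemma monotone_path_bounds:
  assumes "monotone_path a b h" "t \<in> {0..1}"
  shows "h t \<in> {a..b}"
  using assms mono_onD[of "{0..1}" h 0 t] mono_onD[of "{0..1}" h t 1]
  by (auto simp: monotone_path_def)

lemma monotone_path_imp_le: "monotone_path a b h \<Longrightarrow> a \<le> b"
  using monotone_path_bounds[of a b h 0] by simp

lemma frechet_leE:
  assumes "frechet_le D f a b g c d"
  obtains h k where "monotone_path a b h" "monotone_path c d k"
    "\<forall>t\<in>{0..1}. \<bar>f (h t) - g (k t)\<bar> \<le> D"
  using assms unfolding frechet_le_def by blast

lemma frechet_le_imp_le:
  assumes "frechet_le D f a b g c d"
  shows "a \<le> b" "c \<le> d"
  using assms monotone_path_imp_le unfolding frechet_le_def by blast+

lemma frechet_le_start: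
  assumes "frechet_le D f a b g c d"
  shows "\<bar>f a - g c\<bar> \<le> D"
  by (rule frechet_leE[OF assms]) (auto simp: monotone_path_def dest: bspec[of _ _ 0])

lemma frechet_le_end:
  assumes "frechet_le D f a b g c d"
  shows "\<bar>f b - g d\<bar> \<le> D"
  by (rule frechet_leE[OF assms]) (auto simp: monotone_path_def dest: bspec[of _ _ 1])

lemma frechet_le_sym:
  assumes "frechet_le D f a b g c d"
  shows "frechet_le D g c d f a b"
  using assms unfolding frechet_le_def by (metis abs_minus_commute)

lemma frechet_le_minus:
  assumes "frechet_le D f a b g c d"
  shows "frechet_le D (\<lambda>s. - f s) a b (\<lambda>t. - g t) c d"
proof -
  have "\<bar>- x - - y\<bar> = \<bar>x - y\<bar>" for x y :: real
    by simp
  then show ?thesis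
    using assms unfolding frechet_le_def by simp
qed

text \<open>Negating times keeps intervals oriented while both curves run backwards. This later
  reduces a decreasing signature edge to an increasing one.\<close>

lemma frechet_le_reverse:
  assumes "frechet_le D f a b g c d"
  shows "frechet_le D (\<lambda>s. f (- s)) (- b) (- a) (\<lambda>t. g (- t)) (- d) (- c)"
proof -
  obtain h k where hk: "monotone_path a b h" "monotone_path c d k"
      "\<forall>t\<in>{0..1}. \<bar>f (h t) - g (k t)\<bar> \<le> D"
    using assms by (rule frechet_leE)
  have "monotone_path (- y) (- x) (\<lambda>t. - p (1 - t))" if "monotone_path x y p" for x y p
    using that unfolding monotone_path_def
    by (auto simp: mono_on_def intro!: continuous_intros continuous_on_compose2[of "{0..1}" p])
  then show ?thesis
    unfolding frechet_le_def
    by (intro exI[of _ "\<lambda>t. - h (1 - t)"] exI[of _ "\<lambda>t. - k (1 - t)"]) (use hk in auto)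
qed

lemma mono_on_joinpaths:
  fixes g1 g2 :: "real \<Rightarrow> real"
  assumes "mono_on {0..1} g1" "mono_on {0..1} g2" "g1 1 = g2 0"
  shows "mono_on {0..1} (g1 +++ g2)"
proof (rule mono_onI)
  fix x y :: real
  assume xy: "x \<in> {0..1}" "y \<in> {0..1}" "x \<le> y"
  consider "y \<le> 1/2" | "x \<le> 1/2" "y > 1/2" | "x > 1/2"
    using xy by linarith
  then show "(g1 +++ g2) x \<le> (g1 +++ g2) y"
  proof cases
    case 1
    then show ?thesis
      using xy by (auto simp: joinpaths_def intro!: mono_onD[OF assms(1)])
  next
    case 2
    have "g1 (2 * x) \<le> g1 1"
      using 2 xy by (intro mono_onD[OF assms(1)]) auto
    moreover have "g2 0 \<le> g2 (2 * y - 1)"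
      using 2 xy by (intro mono_onD[OF assms(2)]) auto
    ultimately show ?thesis
      using 2 assms(3) by (simp add: joinpaths_def)
  next
    case 3
    then show ?thesis
      using xy by (auto simp: joinpaths_def intro!: mono_onD[OF assms(2)])
  qed
qed

lemma frechet_le_join:
  assumes "frechet_le D f a b g c d" "frechet_le D f b b' g d d'"
  shows "frechet_le D f a b' g c d'"
proof -
  obtain h k where hk: "monotone_path a b h" "monotone_path c d k"
      "\<forall>t\<in>{0..1}. \<bar>f (h t) - g (k t)\<bar> \<le> D"
    using assms(1) by (rule frechet_leE)
  obtain h' k' where hk': "monotone_path b b' h'" "monotone_path d d' k'"
      "\<forall>t\<in>{0..1}. \<bar>f (h' t) - g (k' t)\<bar> \<le> D"
    using assms(2) by (rule frechet_leE)
  have "monotone_path x z (p1 +++ p2)" if "monotone_path x y p1" "monotone_path y z p2" for x y z p1 p2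
    using that unfolding monotone_path_def
    by (auto intro!: continuous_on_joinpaths mono_on_joinpaths simp: pathfinish_def pathstart_def)
      (simp_all add: joinpaths_def)
  moreover have "\<bar>f ((h +++ h') t) - g ((k +++ k') t)\<bar> \<le> D" if "t \<in> {0..1}" for t
    using that bspec[OF hk(3), of "2 * t"] bspec[OF hk'(3), of "2 * t - 1"]
    by (auto simp: joinpaths_def)
  ultimately show ?thesis
    unfolding frechet_le_def using hk hk' by blast
qed

lemma frechet_le_split:
  assumes "frechet_le D f a b g c d" "a \<le> s" "s \<le> b"
  obtains t where "c \<le> t" "t \<le> d" "frechet_le D f a s g c t" "frechet_le D f s b g t d"
proof -
  obtain h k where hk: "monotone_path a b h" "monotone_path c d k"
      "\<forall>t\<in>{0..1}. \<bar>f (h t) - g (k t)\<bar> \<le> D"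
    using assms(1) by (rule frechet_leE)
  \<comment> \<open>The intermediate value theorem gives a parameter \<open>x\<close> at which the
    path in \<open>f\<close> is at \<open>s\<close>. The time on the other curve is
    \<open>k x\<close>, and \<open>lin\<close> rescales the two parts of
    \<open>[0, 1]\<close>.\<close>
  obtain x where x: "0 \<le> x" "x \<le> 1" "h x = s"
    using IVT'[of h 0 s 1] hk assms(2,3) by (auto simp: monotone_path_def)
  have lin: "monotone_path u v (\<lambda>t. u + (v - u) * t)" if "u \<le> v" for u v
    using that by (auto simp: monotone_path_def intro!: continuous_intros mono_onI mult_left_mono)
  have "monotone_path 0 x (\<lambda>t. 0 + (x - 0) * t)" "monotone_path x 1 (\<lambda>t. x + (1 - x) * t)"
    using x by (intro lin; simp)+
  then have q: "monotone_path 0 x (\<lambda>t. x * t)" "monotone_path x 1 (\<lambda>t. x + (1 - x) * t)"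
    by simp_all
  note q01 = monotone_path_bounds[OF q(1)] monotone_path_bounds[OF q(2)]
  have pq: "monotone_path (p u) (p v) (\<lambda>t. p (q t))"
    if "monotone_path a b p" "monotone_path u v q" "0 \<le> u" "v \<le> 1" for a b p u v q
  proof -
    have q01: "q t \<in> {0..1}" if "t \<in> {0..1}" for t
      using monotone_path_bounds[OF \<open>monotone_path u v q\<close> that] \<open>0 \<le> u\<close> \<open>v \<le> 1\<close> by auto
    have p: "continuous_on {0..1} p" "mono_on {0..1} p"
      and q: "continuous_on {0..1} q" "mono_on {0..1} q" "q 0 = u" "q 1 = v"
      using that by (simp_all add: monotone_path_def)
    have "continuous_on {0..1} (\<lambda>t. p (q t))"
      using continuous_on_compose2[OF p(1) q(1)] q01 by blast
    moreover have "mono_on {0..1} (\<lambda>t. p (q t))"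
      using mono_onD[OF p(2) q01 q01 mono_onD[OF q(2)]] by (intro mono_onI)
    ultimately show ?thesis
      using q by (simp add: monotone_path_def)
  qed
  have ends: "h 0 = a" "h 1 = b" "k 0 = c" "k 1 = d"
    using hk by (auto simp: monotone_path_def)
  show thesis
  proof (rule that[of "k x"])
    show "c \<le> k x" "k x \<le> d"
      using monotone_path_bounds[OF hk(2), of x] x by auto
    show "frechet_le D f a s g c (k x)"
      unfolding frechet_le_def
    proof (intro exI conjI ballI)
      show "monotone_path a s (\<lambda>t. h (x * t))" "monotone_path c (k x) (\<lambda>t. k (x * t))"
        using pq[OF hk(1) q(1)] pq[OF hk(2) q(1)] x ends by auto
      show "\<bar>f (h (x * t)) - g (k (x * t))\<bar> \<le> D" if "t \<in> {0..1}" for t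
        using hk(3) q01(1)[OF that] x by auto
    qed
    show "frechet_le D f s b g (k x) d"
      unfolding frechet_le_def
    proof (intro exI conjI ballI)
      show "monotone_path s b (\<lambda>t. h (x + (1 - x) * t))" "monotone_path (k x) d (\<lambda>t. k (x + (1 - x) * t))"
        using pq[OF hk(1) q(2)] pq[OF hk(2) q(2)] x ends by auto
      show "\<bar>f (h (x + (1 - x) * t)) - g (k (x + (1 - x) * t))\<bar> \<le> D" if "t \<in> {0..1}" for t
        using hk(3) q01(2)[OF that] x by auto
    qed
  qed
qed

lemma frechet_le_split_right:
  assumes "frechet_le D f a b g c d" "c \<le> t" "t \<le> d"
  obtains s where "a \<le> s" "s \<le> b" "frechet_le D f a s g c t" "frechet_le D f s b g t d"
proof -
  obtain s where s: "a \<le> s" "s \<le> b" "frechet_le D g c t f a s" "frechet_le D g t d f s b"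
    by (rule frechet_le_split[OF frechet_le_sym[OF assms(1)] assms(2,3)]) (rule that)
  show thesis
    by (rule that[OF s(1,2) frechet_le_sym[OF s(3)] frechet_le_sym[OF s(4)]])
qed

lemma frechet_le_matched:
  assumes "frechet_le D f a b g c d" "a \<le> s" "s \<le> b"
  obtains t where "c \<le> t" "t \<le> d" "\<bar>f s - g t\<bar> \<le> D"
proof -
  obtain t where "c \<le> t" "t \<le> d" "frechet_le D f a s g c t"
    by (rule frechet_le_split[OF assms]) (rule that)
  with frechet_le_end show thesis
    by (intro that[of t])
qed

lemma frechet_le_matched_right:
  assumes "frechet_le D f a b g c d" "c \<le> t" "t \<le> d"
  obtains s where "a \<le> s" "s \<le> b" "\<bar>f s - g t\<bar> \<le> D"
proof -
  obtain s where "a \<le> s" "s \<le> b" "frechet_le D f a s g c t"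
    by (rule frechet_le_split_right[OF assms]) (rule that)
  with frechet_le_end show thesis
    by (intro that[of s])
qed

section \<open>Waiting and changes of speed\<close>

lemma frechet_le_wait:
  assumes "a \<le> b" "\<And>s. a \<le> s \<Longrightarrow> s \<le> b \<Longrightarrow> \<bar>f s - g c\<bar> \<le> D"
  shows "frechet_le D f a b g c c"
proof -
  have *: "a + t * (b - a) \<le> b" if "0 \<le> t" "t \<le> 1" for t
    using mult_right_mono[of t 1 "b - a"] that assms(1) by simp
  show ?thesis
    unfolding frechet_le_def monotone_path_def
    by (rule exI[of _ "\<lambda>t. a + t * (b - a)"], rule exI[of _ "\<lambda>t. c"])
      (use assms * in \<open>auto intro!: continuous_intros mono_onI mult_right_mono\<close>)
qed

lemma frechet_le_wait_right:
  assumes "c \<le> d" "\<And>t. c \<le> t \<Longrightarrow> t \<le> d \<Longrightarrow> \<bar>f a - g t\<bar> \<le> D"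
  shows "frechet_le D f a a g c d"
proof (rule frechet_le_sym, rule frechet_le_wait)
  show "\<bar>g t - f a\<bar> \<le> D" if "c \<le> t" "t \<le> d" for t
    using assms(2)[OF that] by (simp add: abs_minus_commute)
qed (fact assms(1))

text \<open>Composing the path in \<open>g\<close> with \<open>\<psi>\<close> gives a path in
  \<open>g'\<close> through the same values. Since \<open>\<psi>\<close> is only weakly monotone,
  stretches of time may be collapsed.\<close>

lemma frechet_le_reparam:
  assumes "frechet_le D f a b g c d" "continuous_on {c..d} \<psi>" "mono_on {c..d} \<psi>"
    and "\<And>t. c \<le> t \<Longrightarrow> t \<le> d \<Longrightarrow> g' (\<psi> t) = g t"
  shows "frechet_le D f a b g' (\<psi> c) (\<psi> d)"
proof -
  obtain h k where hk: "monotone_path a b h" "monotone_path c d k"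
      "\<forall>t\<in>{0..1}. \<bar>f (h t) - g (k t)\<bar> \<le> D"
    using assms(1) by (rule frechet_leE)
  note k = monotone_path_bounds[OF hk(2)]
  have kcont: "continuous_on {0..1} k" and kmono: "mono_on {0..1} k"
    using hk(2) by (simp_all add: monotone_path_def)
  have "continuous_on {0..1} (\<lambda>t. \<psi> (k t))"
    using continuous_on_compose2[OF assms(2) kcont] k by blast
  moreover have "mono_on {0..1} (\<lambda>t. \<psi> (k t))"
    using mono_onD[OF assms(3) k k mono_onD[OF kmono]] by (intro mono_onI)
  ultimately have "monotone_path (\<psi> c) (\<psi> d) (\<lambda>t. \<psi> (k t))"
    using hk(2) by (simp add: monotone_path_def)
  then show ?thesis
    unfolding frechet_le_def
    by (intro exI[of _ h] exI[of _ "\<lambda>t. \<psi> (k t)"]) (use hk k assms(4) in auto)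
qed

lemma frechet_le_cong:
  assumes "frechet_le D f a b g c d" "\<And>t. c \<le> t \<Longrightarrow> t \<le> d \<Longrightarrow> g' t = g t"
  shows "frechet_le D f a b g' c d"
  using frechet_le_reparam[OF assms(1), of "\<lambda>t. t" g'] assms(2)
  by (simp add: mono_on_def)

text \<open>A monotone continuous piece differs from the straight segment between its end values
  only in timing: the relative height \<open>\<theta>\<close> is the change of time. This is how a
  cut peak turns into the edge between its neighbours.\<close>

lemma frechet_le_monotone_to_linear:
  assumes "frechet_le D f a b g c d" "continuous_on {c..d} g"
    and mono: "mono_on {c..d} g \<or> antimono_on {c..d} g"
    and "c' < d'" and lin: "\<And>x. 0 \<le> x \<Longrightarrow> x \<le> 1 \<Longrightarrow> g' (c' + x * (d' - c')) = (1 - x) * g c + x * g d"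
  shows "frechet_le D f a b g' c' d'"
proof (cases "g c = g d \<or> c = d")
  case True
  have cd: "c \<le> d"
    using frechet_le_imp_le[OF assms(1)] by simp
  have const: "g t = g d" if "c \<le> t" "t \<le> d" for t
  proof -
    have "(g c \<le> g t \<and> g t \<le> g d) \<or> (g d \<le> g t \<and> g t \<le> g c)"
      using mono that cd
      by (auto dest: mono_onD[of _ _ c t] mono_onD[of _ _ t d] monotone_onD[of _ _ _ _ c t] monotone_onD[of _ _ _ _ t d])
    then show ?thesis
      using True that by auto
  qed
  have gd: "g' s = g d" if "c' \<le> s" "s \<le> d'" for s
  proof -
    have "g' (c' + x * (d' - c')) = g d" if "0 \<le> x" "x \<le> 1" for x
      using lin[OF that] True by (auto simp: algebra_simps)
    from this[of "(s - c') / (d' - c')"] show ?thesis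
      using that \<open>c' < d'\<close> by simp
  qed
  \<comment> \<open>A constant piece has no relative height. All of it is collapsed to the time
    \<open>c'\<close>, and the constant segment is run through afterwards while \<open>f\<close>
    rests at \<open>b\<close>.\<close>
  have "frechet_le D f a b g' c' c'"
  proof (rule frechet_le_reparam[OF assms(1), of "\<lambda>_. c'"])
    show "g' c' = g t" if "c \<le> t" "t \<le> d" for t
      using const[OF that] gd[of c'] \<open>c' < d'\<close> by simp
  qed (auto simp: mono_on_def)
  moreover have "frechet_le D f b b g' c' d'"
    by (rule frechet_le_wait_right) (use frechet_le_end[OF assms(1)] gd \<open>c' < d'\<close> in simp_all)
  ultimately show ?thesis
    by (rule frechet_le_join)
next
  case False
  have cd: "c \<le> d"
    using frechet_le_imp_le[OF assms(1)] by simp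
  define \<theta> where "\<theta> t = (g t - g c) / (g d - g c)" for t
  have \<theta>01: "0 \<le> \<theta> t" "\<theta> t \<le> 1" if "c \<le> t" "t \<le> d" for t
    using mono that cd False
    by (auto simp: \<theta>_def divide_simps
        dest: mono_onD[of _ _ c t] mono_onD[of _ _ t d] monotone_onD[of _ _ _ _ c t] monotone_onD[of _ _ _ _ t d])
  have \<theta>mono: "\<theta> s \<le> \<theta> t" if "c \<le> s" "s \<le> t" "t \<le> d" for s t
  proof -
    have "(g s \<le> g t \<and> g c \<le> g d) \<or> (g t \<le> g s \<and> g d \<le> g c)"
      using mono that cd
      by (auto dest: mono_onD[of _ _ s t] mono_onD[of _ _ c d] monotone_onD[of _ _ _ _ s t] monotone_onD[of _ _ _ _ c d])
    then show ?thesis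
      unfolding \<theta>_def
      using divide_right_mono[of "g s - g c" "g t - g c" "g d - g c"]
        divide_right_mono_neg[of "g t - g c" "g s - g c" "g d - g c"] by auto
  qed
  have g\<theta>: "(1 - \<theta> t) * g c + \<theta> t * g d = g t" for t
  proof -
    have "\<theta> t * (g d - g c) = g t - g c"
      using False by (simp add: \<theta>_def)
    then show ?thesis
      by (simp add: algebra_simps)
  qed
  have "frechet_le D f a b g' (c' + \<theta> c * (d' - c')) (c' + \<theta> d * (d' - c'))"
  proof (rule frechet_le_reparam[OF assms(1), of "\<lambda>t. c' + \<theta> t * (d' - c')"])
    show "continuous_on {c..d} (\<lambda>t. c' + \<theta> t * (d' - c'))"
      unfolding \<theta>_def by (intro continuous_intros assms) (use False in auto)
    show "mono_on {c..d} (\<lambda>t. c' + \<theta> t * (d' - c'))"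
      using \<theta>mono \<open>c' < d'\<close> by (auto intro!: mono_onI)
    show "g' (c' + \<theta> t * (d' - c')) = g t" if "c \<le> t" "t \<le> d" for t
      by (simp only: lin[OF \<theta>01[OF that]] g\<theta>)
  qed
  moreover have "\<theta> c = 0" "\<theta> d = 1"
    using False by (auto simp: \<theta>_def)
  ultimately show ?thesis
    by simp
qed

text \<open>The schedule used at a low point \<open>m\<close>: \<open>f\<close> comes to
  \<open>m\<close> while \<open>g\<close> waits, rests there during the whole motion of
  \<open>g\<close>, and then goes on alone.\<close>

lemma frechet_le_perform:
  assumes "e \<le> m" "m \<le> T" "\<eta> \<le> y"
    and "\<And>s. e \<le> s \<Longrightarrow> s \<le> m \<Longrightarrow> \<bar>f s - g \<eta>\<bar> \<le> D"
    and "\<And>t. \<eta> \<le> t \<Longrightarrow> t \<le> y \<Longrightarrow> \<bar>f m - g t\<bar> \<le> D"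
    and "\<And>s. m \<le> s \<Longrightarrow> s \<le> T \<Longrightarrow> \<bar>f s - g y\<bar> \<le> D"
  shows "frechet_le D f e T g \<eta> y"
proof -
  have "frechet_le D f e m g \<eta> \<eta>"
    by (rule frechet_le_wait) (use assms in auto)
  moreover have "frechet_le D f m m g \<eta> y"
    by (rule frechet_le_wait_right) (use assms in auto)
  moreover have "frechet_le D f m T g y y"
    by (rule frechet_le_wait) (use assms in auto)
  ultimately show ?thesis
    by (blast intro: frechet_le_join)
qed

section \<open>Hitting times and extrema of continuous functions\<close>

lemma continuous_last_hit:
  fixes f :: "real \<Rightarrow> real"
  assumes "continuous_on {a..b} f" "a \<le> s0" "s0 \<le> b" "f s0 \<le> v" "v \<le> f b"
  obtains s where "s0 \<le> s" "s \<le> b" "f s = v" "\<And>x. s \<le> x \<Longrightarrow> x \<le> b \<Longrightarrow> v \<le> f x"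
proof -
  \<comment> \<open>The last hit is the maximum of this compact set. All later values exceed
    \<open>v\<close>, and the intermediate value theorem forces equality at the maximum.\<close>
  define S where "S = {x \<in> {s0..b}. f x \<le> v}"
  have cont: "continuous_on {u..b} f" if "s0 \<le> u" for u
    by (rule continuous_on_subset[OF assms(1)]) (use assms(2) that in auto)
  have "closed S"
    unfolding S_def by (rule continuous_on_closed_Collect_le[OF cont]) auto
  moreover have "S \<subseteq> {s0..b}"
    by (auto simp: S_def)
  ultimately have "compact S"
    by (metis compact_Icc compact_Int_closed inf.absorb_iff2)
  moreover have "S \<noteq> {}"
    using assms(3,4) by (auto simp: S_def)
  ultimately obtain s where s: "s \<in> S" "\<And>x. x \<in> S \<Longrightarrow> x \<le> s"
    using compact_attains_sup[of S] by auto
  have "s0 \<le> s" "s \<le> b" "f s \<le> v"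
    using s(1) by (auto simp: S_def)
  then obtain x where x: "s \<le> x" "x \<le> b" "f x = v"
    using IVT'[of f s v b] cont[of s] assms(5) by auto
  have "x \<in> S"
    using x \<open>s0 \<le> s\<close> by (auto simp: S_def)
  then have "f s = v"
    using s(2) x by force
  moreover have "v \<le> f x" if "s \<le> x" "x \<le> b" for x
    using s(2)[of x] that \<open>s0 \<le> s\<close> \<open>f s = v\<close> by (cases "x = s") (force simp: S_def)+
  ultimately show thesis
    using that \<open>s0 \<le> s\<close> \<open>s \<le> b\<close> by blast
qed

lemma continuous_first_hit:
  fixes f :: "real \<Rightarrow> real"
  assumes "continuous_on {a..b} f" "a \<le> b" "f a \<le> v" "v \<le> f b"
  obtains s where "a \<le> s" "s \<le> b" "f s = v" "\<And>x. a \<le> x \<Longrightarrow> x \<le> s \<Longrightarrow> f x \<le> v"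
proof -
  have cont: "continuous_on {- b..- a} (\<lambda>x. - f (- x))"
    by (intro continuous_intros continuous_on_compose2[OF assms(1)]) auto
  obtain s where s: "- b \<le> s" "s \<le> - a" "- f (- s) = - v"
      "\<And>x. s \<le> x \<Longrightarrow> x \<le> - a \<Longrightarrow> - v \<le> - f (- x)"
    by (rule continuous_last_hit[OF cont, of "- b" "- v"]) (use assms in auto)
  show thesis
    by (rule that[of "- s"]) (use s(1,2,3) s(4)[of "- x" for x] in auto)
qed

lemma continuous_argmax:
  fixes f :: "real \<Rightarrow> real"
  assumes "continuous_on {a..b} f" "a \<le> u" "u \<le> v" "v \<le> b"
  obtains p where "u \<le> p" "p \<le> v" "\<And>s. u \<le> s \<Longrightarrow> s \<le> v \<Longrightarrow> f s \<le> f p"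
proof -
  have "continuous_on {u..v} f"
    by (rule continuous_on_subset[OF assms(1)]) (use assms in auto)
  then show thesis
    using continuous_attains_sup[of "{u..v}" f] assms(3) that by auto
qed

lemma continuous_argmin:
  fixes f :: "real \<Rightarrow> real"
  assumes "continuous_on {a..b} f" "a \<le> u" "u \<le> v" "v \<le> b"
  obtains p where "u \<le> p" "p \<le> v" "\<And>s. u \<le> s \<Longrightarrow> s \<le> v \<Longrightarrow> f p \<le> f s"
proof -
  have "continuous_on {u..v} f"
    by (rule continuous_on_subset[OF assms(1)]) (use assms in auto)
  then show thesis
    using continuous_attains_inf[of "{u..v}" f] assms(3) that by auto
qed

section \<open>Cutting a peak opposite an increasing edge\<close>

text \<open>
  \<open>Qc\<close> is \<open>Q\<close> with the peak of height \<open>w\<close> at time \<open>sg\<close> cut off at height \<open>z\<close>. The edge of the signature that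
  contains the point matched with the peak spans \<open>[l, r]\<close> and increases. The last assumption says
  what precedes the edge: nothing, or a valley at \<open>l\<close> that is entered from a high point \<open>l0\<close>.
\<close>

locale matched_bump =
  fixes D :: real and P Q Qc :: "real \<Rightarrow> real" and A B C E x1 c b t1 sg t2 z w l r :: real
  assumes D: "D > 0"
    and contP: "continuous_on {A..B} P" and contQ: "continuous_on {C..E} Q"
    and Qt: "Q t1 = z" "Q t2 = z" "Q sg = w"
    and Qup: "\<And>t t'. t1 \<le> t \<Longrightarrow> t \<le> t' \<Longrightarrow> t' \<le> sg \<Longrightarrow> Q t \<le> Q t'"
    and Qdown: "\<And>t t'. sg \<le> t \<Longrightarrow> t \<le> t' \<Longrightarrow> t' \<le> t2 \<Longrightarrow> Q t' \<le> Q t"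
    and Qc_in: "\<And>t. t1 \<le> t \<Longrightarrow> t \<le> t2 \<Longrightarrow> Qc t = z"
    and Qc_out: "\<And>t. t \<le> t1 \<or> t2 \<le> t \<Longrightarrow> Qc t = Q t"
    and mAx: "frechet_le D P A x1 Q C t1"
    and mxc: "frechet_le D P x1 c Q t1 sg"
    and mcb: "frechet_le D P c b Q sg t2"
    and mbB: "frechet_le D P b B Q t2 E"
    and edge: "A \<le> l" "l \<le> c" "c \<le> r" "r \<le> B"
    and Pmono: "\<And>s s'. l \<le> s \<Longrightarrow> s \<le> s' \<Longrightarrow> s' \<le> r \<Longrightarrow> P s \<le> P s' + 2 * D"
    and Pr: "P r > w + D"
    and left: "(l = A \<and> P A < w - 3 * D) \<or>
      (\<exists>l0. A \<le> l0 \<and> l0 \<le> l \<and> (\<forall>s. l0 \<le> s \<longrightarrow> s \<le> r \<longrightarrow> P l \<le> P s) \<and>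
        (P l0 > P l + 2 * D \<or> (l0 = A \<and> \<bar>w - P A\<bar> > 3 * D)))"
begin

section \<open>Bounds on \<open>P\<close> around the peak\<close>

lemmas order_P = frechet_le_imp_le(1)[OF mAx] frechet_le_imp_le(1)[OF mxc]
  frechet_le_imp_le(1)[OF mcb] frechet_le_imp_le(1)[OF mbB]

lemmas order_Q = frechet_le_imp_le(2)[OF mAx] frechet_le_imp_le(2)[OF mxc]
  frechet_le_imp_le(2)[OF mcb] frechet_le_imp_le(2)[OF mbB]

lemma Q_bump: "z \<le> Q t \<and> Q t \<le> w" if "t1 \<le> t" "t \<le> t2"
proof (cases "t \<le> sg")
  case True
  then show ?thesis
    using Qup[of t1 t] Qup[of t sg] that order_Q Qt by auto
next
  case False
  then show ?thesis
    using Qdown[of sg t] Qdown[of t t2] that order_Q Qt by auto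
qed

lemma P_bump: "z - D \<le> P s \<and> P s \<le> w + D" if s: "x1 \<le> s" "s \<le> b"
proof -
  have "frechet_le D P x1 b Q t1 t2"
    using mxc mcb by (rule frechet_le_join)
  then obtain t where "t1 \<le> t" "t \<le> t2" "\<bar>P s - Q t\<bar> \<le> D"
    using s by (rule frechet_le_matched)
  then show ?thesis
    using Q_bump[of t] by auto
qed

lemma b_le_r: "b \<le> r"
  using P_bump[of r] Pr edge order_P by force

text \<open>Up to \<open>c\<close> the curve \<open>P\<close> follows the climb of \<open>Q\<close>
  to the peak, so it loses at most \<open>2 * D\<close>, namely \<open>D\<close> for each of the two
  matched pairs.\<close>

lemma P_before_l: "P s \<le> P l + 2 * D" if s: "x1 \<le> s" "s \<le> l"
proof -
  obtain v where v: "t1 \<le> v" "v \<le> sg" "frechet_le D P x1 l Q t1 v"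
    by (rule frechet_le_split[OF mxc, of l]) (use s edge in auto)
  obtain u where u: "t1 \<le> u" "u \<le> v" "\<bar>P s - Q u\<bar> \<le> D"
    by (rule frechet_le_matched[OF v(3) s])
  show ?thesis
    using frechet_le_end[OF v(3)] u Qup[of u v] v by auto
qed

text \<open>The point \<open>l0\<close> is either the start \<open>A\<close> or too high to lie
  opposite the climb, by \<open>P_before_l\<close>. So it is not after \<open>x1\<close>, and the
  stretch on which \<open>P l\<close> is the minimum contains everything from \<open>x1\<close> to
  \<open>r\<close>.\<close>

lemma P_after_x1: "P l \<le> P s" if "x1 < l" "x1 \<le> s" "s \<le> r"
proof -
  have "l \<noteq> A"
    using that order_P by auto
  then obtain l0 where l0: "A \<le> l0" "l0 \<le> l" "\<And>s. l0 \<le> s \<Longrightarrow> s \<le> r \<Longrightarrow> P l \<le> P s"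
      "P l0 > P l + 2 * D \<or> l0 = A"
    using left by auto
  have "l0 \<le> x1"
    using P_before_l[of l0] l0 order_P by force
  then show ?thesis
    using l0(3)[of s] that by auto
qed

text \<open>Extends the \<open>2 * D\<close>-monotonicity of the edge back to \<open>x1\<close>: a
  point before \<open>l\<close> is compared with a later one through the valley at
  \<open>l\<close>.\<close>

lemma P_drop: "P p - 2 * D \<le> P s" if "x1 \<le> p" "p \<le> s" "s \<le> r"
proof (cases "l \<le> p")
  case True
  then show ?thesis
    using Pmono[of p s] that by auto
next
  case False
  then show ?thesis
    using P_before_l[of p] P_after_x1[of s] that by auto
qed

text \<open>If \<open>P A\<close> were not this low, the assumption \<open>left\<close> would yield
  a point \<open>l0\<close> that is higher than \<open>P l + 2 * D\<close>, or is the start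
  \<open>A\<close> at a height above \<open>w + 3 * D\<close>. Its partner on \<open>Q\<close>
  before the peak would reach \<open>P p - D\<close>, contrary to \<open>low\<close>.\<close>

lemma P_start_low:
  assumes p: "x1 \<le> p" "p \<le> T" "T \<le> r"
    and max: "\<And>s. x1 \<le> s \<Longrightarrow> s \<le> T \<Longrightarrow> P s \<le> P p" and "P p \<le> w + D"
    and high: "\<And>s. A \<le> s \<Longrightarrow> s \<le> p \<Longrightarrow> P s > P p - 2 * D"
    and low: "\<And>t. C \<le> t \<Longrightarrow> t \<le> t1 \<Longrightarrow> Q t < P p - D"
  shows "P A < w - 3 * D"
proof (rule ccontr)
  assume PA: "\<not> P A < w - 3 * D"
  then obtain l0 where l0: "A \<le> l0" "l0 \<le> l" "\<And>s. l0 \<le> s \<Longrightarrow> s \<le> r \<Longrightarrow> P l \<le> P s"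
      "P l0 > P l + 2 * D \<or> (l0 = A \<and> \<bar>w - P A\<bar> > 3 * D)"
    using left by auto
  have "P l \<ge> P p - 2 * D"
    using high[of l] P_drop[of p l] p edge by (cases "l \<le> p") auto
  from l0(4) show False
  proof
    assume *: "P l0 > P l + 2 * D"
    have "l0 < x1"
    proof (rule ccontr)
      assume "\<not> l0 < x1"
      then show False
        using * P_before_l[of l0] l0(2) by auto
    qed
    obtain t where "C \<le> t" "t \<le> t1" "\<bar>P l0 - Q t\<bar> \<le> D"
      by (rule frechet_le_matched[OF mAx l0(1)]) (use \<open>l0 < x1\<close> in auto)
    then show False
      using low[of t] * \<open>P l \<ge> P p - 2 * D\<close> by auto
  next
    assume *: "l0 = A \<and> \<bar>w - P A\<bar> > 3 * D"
    then show False
      using PA frechet_le_start[OF mAx] low[of C] order_Q assms(5) D by auto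
  qed
qed

text \<open>
  The invariant of the recursion over the low points \<open>T\<close> of \<open>P\<close>: while \<open>P\<close> stands still at \<open>T\<close>, \<open>Q\<close> can perform
  everything from \<open>t2\<close> to \<open>y\<close>. The bound \<open>lam\<close> is the height of the first low point and stays fixed:
  the motion of \<open>Q\<close> after the peak never falls below \<open>lam - D\<close>, so any point of \<open>P\<close> that is at most \<open>lam\<close>
  is low enough to perform it.
\<close>

definition reach :: "real \<Rightarrow> real \<Rightarrow> real \<Rightarrow> bool" where
  "reach lam T y \<longleftrightarrow> x1 \<le> T \<and> T \<le> r \<and> t2 \<le> y \<and> y \<le> E \<and> P T \<le> lam \<and> Q y - D \<le> P T \<and> Q y \<le> w \<and>
    (\<forall>t. t2 \<le> t \<and> t \<le> y \<longrightarrow> lam - D \<le> Q t \<and> Q t \<le> Q y) \<and>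
    (\<forall>s. x1 \<le> s \<and> s \<le> T \<longrightarrow> z - D \<le> P s \<and> P s \<le> Q y + D)"

section \<open>The recursion over low points\<close>

lemma match_Qc_start: "frechet_le D P A s Qc C t" if "frechet_le D P A s Q C t" "t \<le> t1"
  by (rule frechet_le_cong[OF that(1)]) (use that(2) Qc_out in auto)

text \<open>One round of the recursion. A rise of \<open>P\<close> by \<open>2 * D\<close> takes at
  least the time \<open>\<kappa>\<close>, so the recursive call concerns a low point that is earlier
  by at least \<open>\<kappa>\<close>.\<close>

lemma match_step:
  assumes \<kappa>: "\<And>s s'. A \<le> s \<Longrightarrow> s \<le> s' \<Longrightarrow> s' \<le> B \<Longrightarrow> s' - s < \<kappa> \<Longrightarrow> P s' - P s < 2 * D"
    and lam: "w - 3 * D \<le> lam" and H: "reach lam T y"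
    and IH: "\<And>a y'. x1 < a \<Longrightarrow> a \<le> T - \<kappa> \<Longrightarrow> reach lam a y' \<Longrightarrow> frechet_le D P A a Qc C y'"
  shows "frechet_le D P A T Qc C y"
proof -
  have HT: "x1 \<le> T" "T \<le> r" "t2 \<le> y" "y \<le> E" "P T \<le> lam" "Q y - D \<le> P T" "Q y \<le> w"
    and HQ: "\<And>t. t2 \<le> t \<Longrightarrow> t \<le> y \<Longrightarrow> lam - D \<le> Q t \<and> Q t \<le> Q y"
    and HP: "\<And>s. x1 \<le> s \<Longrightarrow> s \<le> T \<Longrightarrow> z - D \<le> P s \<and> P s \<le> Q y + D"
    using H by (auto simp: reach_def)
  have TB: "T \<le> B"
    using HT edge by simp
  have Qc_tail: "lam - D \<le> Qc t \<and> Qc t \<le> Q y'"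
    if "t1 \<le> t" "t \<le> y'" "t2 \<le> y'" "y' \<le> y" "\<And>t. t2 \<le> t \<Longrightarrow> t \<le> y' \<Longrightarrow> Q t \<le> Q y'" for t y'
  proof (cases "t \<le> t2")
    case True
    then show ?thesis
      using HQ[of t2] that(5)[of t2] Qt Qc_in[of t] that by auto
  next
    case False
    then show ?thesis
      using HQ[of t] that(5)[of t] Qc_out[of t] that by auto
  qed
  obtain p where p: "x1 \<le> p" "p \<le> T" and max: "\<And>s. x1 \<le> s \<Longrightarrow> s \<le> T \<Longrightarrow> P s \<le> P p"
    by (rule continuous_argmax[OF contP, of x1 T]) (use HT TB order_P in auto)
  define M where "M = P p"
  show ?thesis
  proof (cases "M \<le> z + D")
    case True
    \<comment> \<open>No obstruction here: \<open>Qc\<close> waits at height \<open>z\<close> until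
      \<open>P\<close> has arrived at \<open>T\<close>, and performs the rest there.\<close>
    have "frechet_le D P A x1 Qc C t1"
      by (rule match_Qc_start[OF mAx]) simp
    moreover have "frechet_le D P x1 T Qc t1 y"
    proof (rule frechet_le_perform)
      show "\<bar>P s - Qc t1\<bar> \<le> D" if "x1 \<le> s" "s \<le> T" for s
        using max[OF that] HP[OF that] True Qc_in[of t1] order_Q by (auto simp: M_def)
      show "\<bar>P T - Qc t\<bar> \<le> D" if "t1 \<le> t" "t \<le> y" for t
        using Qc_tail[of t y] HQ that HT by auto
      then show "\<bar>P s - Qc y\<bar> \<le> D" if "T \<le> s" "s \<le> T" for s
        using that HT order_Q by auto
    qed (use HT order_Q in auto)
    ultimately show ?thesis
      by (rule frechet_le_join)
  next
    case False
    \<comment> \<open>The lowest height within \<open>D\<close> of the maximum \<open>M\<close>. It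
      suffices to match up to the time \<open>y2\<close> at which \<open>Q\<close> regains this
      height, since the motion from \<open>y2\<close> to \<open>y\<close> can be performed at
      \<open>T\<close>.\<close>
    define q where "q = M - D"
    have q: "z < q" "q \<le> Q y"
      using False HP[of p] p by (auto simp: q_def M_def)
    have "continuous_on {t2..y} Q"
      by (rule continuous_on_subset[OF contQ]) (use HT order_Q in auto)
    then obtain y2 where y2: "t2 \<le> y2" "y2 \<le> y" "Q y2 = q"
        and y2_first: "\<And>t. t2 \<le> t \<Longrightarrow> t \<le> y2 \<Longrightarrow> Q t \<le> q"
      by (rule continuous_first_hit[of t2 y Q q]) (use HT q Qt in auto)
    have Qc_y2: "Qc y2 = q"
      using Qc_out y2 by auto
    have tail: "lam - D \<le> Qc t \<and> Qc t \<le> q" if "t1 \<le> t" "t \<le> y2" for t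
      using Qc_tail[of t y2] that y2 y2_first by auto
    have P_late: "M - 2 * D \<le> P s" if "p \<le> s" "s \<le> T" for s
      using P_drop[of p s] that p HT by (auto simp: M_def)
    have "frechet_le D P A T Qc C y2"
    proof -
      \<comment> \<open>\<open>\<eta>\<close> is the last time before the peak at which
        \<open>Q\<close> has height \<open>q\<close>, or the start if \<open>Q\<close> stays below
        \<open>q\<close> there. From \<open>\<eta>\<close> to \<open>t1\<close> the curve
        \<open>Q\<close> is at most \<open>q\<close>, so from \<open>e\<close> on \<open>P\<close>
        is at most \<open>M\<close>.\<close>
      obtain e \<eta> where e: "A \<le> e" "e \<le> x1" "C \<le> \<eta>" "\<eta> \<le> t1"
          and me: "frechet_le D P A e Q C \<eta>" "frechet_le D P e x1 Q \<eta> t1"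
          and Q_e: "\<And>t. \<eta> \<le> t \<Longrightarrow> t \<le> t1 \<Longrightarrow> Q t \<le> q"
          and e_cases: "Q \<eta> = q \<or> (e = A \<and> (\<forall>t. C \<le> t \<and> t \<le> t1 \<longrightarrow> Q t < q))"
      proof (cases "\<exists>t. C \<le> t \<and> t \<le> t1 \<and> q \<le> Q t")
        case True
        then obtain t where t: "C \<le> t" "t \<le> t1" "q \<le> Q t"
          by auto
        have "continuous_on {C..t1} (\<lambda>t. - Q t)"
          by (intro continuous_intros continuous_on_subset[OF contQ]) (use order_Q in auto)
        then obtain \<eta> where \<eta>: "t \<le> \<eta>" "\<eta> \<le> t1" "- Q \<eta> = - q"
            "\<And>x. \<eta> \<le> x \<Longrightarrow> x \<le> t1 \<Longrightarrow> - q \<le> - Q x"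
          by (rule continuous_last_hit[of C t1 _ t "- q"]) (use t q Qt in auto)
        obtain e where "A \<le> e" "e \<le> x1" "frechet_le D P A e Q C \<eta>" "frechet_le D P e x1 Q \<eta> t1"
          by (rule frechet_le_split_right[OF mAx, of \<eta>]) (use \<eta> t in auto)
        then show thesis
          using that[of e \<eta>] \<eta> t by auto
      next
        case False
        have "frechet_le D P A A Q C C"
          by (rule frechet_le_wait) (use frechet_le_start[OF mAx] in auto)
        then show thesis
          using that[of A C] False mAx order_P order_Q by force
      qed
      have P_max: "P s \<le> M" if s: "e \<le> s" "s \<le> T" for s
      proof (cases "x1 \<le> s")
        case True
        then show ?thesis
          using max s by (auto simp: M_def)
      next
        case False
        obtain t where "\<eta> \<le> t" "t \<le> t1" "\<bar>P s - Q t\<bar> \<le> D"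
          by (rule frechet_le_matched[OF me(2) s(1)]) (use False in auto)
        then show ?thesis
          using Q_e[of t] by (auto simp: q_def)
      qed
      \<comment> \<open>The motion from \<open>\<alpha>\<close> to \<open>y2\<close> takes place
        while \<open>P\<close> stands at \<open>m\<close>, then \<open>Qc\<close> waits at height
        \<open>q\<close>. That \<open>m\<close> is low enough follows up to \<open>t1\<close> from
        the comparison with \<open>P\<close> on \<open>[a, x1]\<close>, whose points are the
        partners of that motion, and afterwards from \<open>P m \<le> lam\<close>.\<close>
      have perform: "frechet_le D P A T Qc C y2"
        if "a \<le> m" "m \<le> T" "\<alpha> \<le> t1" "frechet_le D P A a Q C \<alpha>" "frechet_le D P a x1 Q \<alpha> t1"
          "\<eta> \<le> \<alpha>" "P m \<le> lam" "M - 2 * D \<le> P m" "\<And>s. a \<le> s \<Longrightarrow> s \<le> x1 \<Longrightarrow> P m \<le> P s" "e \<le> a"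
          "\<And>s. a \<le> s \<Longrightarrow> s \<le> m \<Longrightarrow> \<bar>P s - Q \<alpha>\<bar> \<le> D"
          "\<And>s. m \<le> s \<Longrightarrow> s \<le> T \<Longrightarrow> M - 2 * D \<le> P s" for a m \<alpha>
      proof -
        have "frechet_le D P a T Qc \<alpha> y2"
        proof (rule frechet_le_perform)
          show "\<bar>P s - Qc \<alpha>\<bar> \<le> D" if "a \<le> s" "s \<le> m" for s
            using \<open>\<alpha> \<le> t1\<close> Qc_out[of \<alpha>] that \<open>\<And>s. a \<le> s \<Longrightarrow> s \<le> m \<Longrightarrow> \<bar>P s - Q \<alpha>\<bar> \<le> D\<close> by auto
          show "\<bar>P m - Qc t\<bar> \<le> D" if "\<alpha> \<le> t" "t \<le> y2" for t
          proof (cases "t \<le> t1")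
            case True
            obtain s where "a \<le> s" "s \<le> x1" "\<bar>P s - Q t\<bar> \<le> D"
              by (rule frechet_le_matched_right[OF \<open>frechet_le D P a x1 Q \<alpha> t1\<close> \<open>\<alpha> \<le> t\<close> True])
            moreover have "Q t \<le> q"
              using Q_e[of t] True that \<open>\<eta> \<le> \<alpha>\<close> by auto
            ultimately show ?thesis
              using \<open>\<And>s. a \<le> s \<Longrightarrow> s \<le> x1 \<Longrightarrow> P m \<le> P s\<close>[of s] \<open>M - 2 * D \<le> P m\<close> Qc_out[of t] True
              by (auto simp: q_def)
          next
            case False
            then show ?thesis
              using tail[of t] that \<open>P m \<le> lam\<close> \<open>M - 2 * D \<le> P m\<close> by (auto simp: q_def)
          qed
          show "\<bar>P s - Qc y2\<bar> \<le> D" if "m \<le> s" "s \<le> T" for s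
            using \<open>\<And>s. m \<le> s \<Longrightarrow> s \<le> T \<Longrightarrow> M - 2 * D \<le> P s\<close>[OF that] P_max[of s] that \<open>a \<le> m\<close> \<open>e \<le> a\<close>
              Qc_y2 by (auto simp: q_def)
        qed (use that order_Q y2 in auto)
        with match_Qc_start[OF that(4) that(3)] show ?thesis
          by (rule frechet_le_join)
      qed
      show ?thesis
      proof (cases "\<exists>s. e \<le> s \<and> s \<le> p \<and> P s \<le> M - 2 * D")
        case True
        then obtain s where s: "e \<le> s" "s \<le> p" "P s \<le> M - 2 * D"
          by auto
        have "continuous_on {e..p} P"
          by (rule continuous_on_subset[OF contP]) (use p e TB in auto)
        \<comment> \<open>From \<open>a\<close> to \<open>T\<close> the curve \<open>P\<close> lies
          between \<open>M - 2 * D\<close> and \<open>M\<close>, so \<open>Qc\<close> may wait at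
          height \<open>q\<close>. As \<open>P a \<le> P T\<close>, the point \<open>a\<close> is
          itself low enough for \<open>lam\<close>.\<close>
        then obtain a where a: "s \<le> a" "a \<le> p" "P a = M - 2 * D"
            "\<And>x. a \<le> x \<Longrightarrow> x \<le> p \<Longrightarrow> M - 2 * D \<le> P x"
          by (rule continuous_last_hit[of e p P s "M - 2 * D"]) (use s D in \<open>auto simp: M_def\<close>)
        have P_a: "M - 2 * D \<le> P s" if "a \<le> s" "s \<le> T" for s
          using a(4)[of s] P_late[of s] that by linarith
        have a_lam: "P a \<le> lam"
          using a(3) P_late[of T] p HT by auto
        show ?thesis
        proof (cases "a \<le> x1")
          case True
          obtain \<alpha> where \<alpha>: "\<eta> \<le> \<alpha>" "\<alpha> \<le> t1" "frechet_le D P e a Q \<eta> \<alpha>" "frechet_le D P a x1 Q \<alpha> t1"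
            by (rule frechet_le_split[OF me(2), of a]) (use s a True in auto)
          have "frechet_le D P A a Q C \<alpha>"
            using me(1) \<alpha>(3) by (rule frechet_le_join)
          show ?thesis
            by (rule perform[of a a \<alpha>])
              (use \<open>frechet_le D P A a Q C \<alpha>\<close> True s a a_lam P_a p \<alpha> HT frechet_le_start[OF \<alpha>(4)] in auto)
        next
          case False
          \<comment> \<open>Now \<open>a\<close> comes after \<open>x1\<close>, so the matching up
            to \<open>a\<close> also has to avoid the peak and is left to the recursion. Between
            \<open>a\<close> and \<open>p\<close> the curve \<open>P\<close> rises by exactly
            \<open>2 * D\<close>, which bounds the time.\<close>
          have "\<not> p - a < \<kappa>"
            using \<kappa>[of a p] a(1,2,3) s e(1) TB p by (auto simp: M_def)
          then have "a \<le> T - \<kappa>"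
            using p by auto
          moreover have "reach lam a y2"
            unfolding reach_def
            using False a a_lam p HT y2 y2_first HQ HP max q by (auto simp: q_def M_def)
          ultimately have "frechet_le D P A a Qc C y2"
            using False by (intro IH) auto
          moreover have "frechet_le D P a T Qc y2 y2"
          proof (rule frechet_le_wait)
            show "\<bar>P s' - Qc y2\<bar> \<le> D" if "a \<le> s'" "s' \<le> T" for s'
              using P_a[OF that] max[of s'] that False Qc_y2 by (auto simp: q_def M_def)
          qed (use a p in auto)
          ultimately show ?thesis
            by (rule frechet_le_join)
        qed
      next
        case False
        then have P_high: "M - 2 * D \<le> P s" if "e \<le> s" "s \<le> T" for s
          using P_late[of s] that by (cases "s \<le> p") force+
        show ?thesis
        proof (cases "Q \<eta> = q")
          case True
          \<comment> \<open>\<open>P\<close> stays within \<open>D\<close> of \<open>q\<close> on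
            all of \<open>[e, T]\<close>. Hence \<open>Qc\<close> can wait at \<open>\<eta>\<close>
            until the minimum of this stretch, perform there, and wait again at
            \<open>y2\<close>.\<close>
          obtain m where m: "e \<le> m" "m \<le> T" "\<And>s. e \<le> s \<Longrightarrow> s \<le> T \<Longrightarrow> P m \<le> P s"
            by (rule continuous_argmin[OF contP, of e T]) (use e HT TB in auto)
          show ?thesis
          proof (rule perform[of e m \<eta>])
            show "P m \<le> lam"
              using m(3)[of T] e HT by auto
            show "\<bar>P s - Q \<eta>\<bar> \<le> D" if "e \<le> s" "s \<le> m" for s
              using P_high[of s] P_max[of s] m that True by (auto simp: q_def)
          qed (use m e me HT P_high in auto)
        next
          case False
          with e_cases have eA: "e = A" and low: "\<And>t. C \<le> t \<Longrightarrow> t \<le> t1 \<Longrightarrow> Q t < q"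
            by auto
          \<comment> \<open>\<open>Q\<close> offers no waiting place at height \<open>q\<close>
            before the peak, but now \<open>P\<close> starts below \<open>w - 3 * D\<close> and
            therefore below \<open>lam\<close>. The minimum of \<open>P\<close> on
            \<open>[A, x1]\<close> is the low point, and the given matching leads to it.\<close>
          have "P A < w - 3 * D"
          proof (rule P_start_low[of p T])
            show "P p \<le> w + D"
              using HP[OF p] HT by auto
            show "P p - 2 * D < P s" if "A \<le> s" "s \<le> p" for s
              using \<open>\<nexists>s. e \<le> s \<and> s \<le> p \<and> P s \<le> M - 2 * D\<close> that eA by (force simp: M_def)
          qed (use p HT max low in \<open>auto simp: q_def M_def\<close>)
          obtain m where m: "A \<le> m" "m \<le> x1" "\<And>s. A \<le> s \<Longrightarrow> s \<le> x1 \<Longrightarrow> P m \<le> P s"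
            by (rule continuous_argmin[OF contP, of A x1]) (use order_P in auto)
          obtain \<alpha> where \<alpha>: "\<eta> \<le> \<alpha>" "\<alpha> \<le> t1" "frechet_le D P e m Q \<eta> \<alpha>" "frechet_le D P m x1 Q \<alpha> t1"
            by (rule frechet_le_split[OF me(2), of m]) (use m eA in auto)
          have m_lam: "P m \<le> lam"
            using m(3)[of A] order_P \<open>P A < w - 3 * D\<close> lam by linarith
          have "frechet_le D P A m Q C \<alpha>"
            using me(1) \<alpha>(3) by (rule frechet_le_join)
          show ?thesis
            by (rule perform[of m m \<alpha>])
              (use \<open>frechet_le D P A m Q C \<alpha>\<close> m \<alpha> eA HT m_lam P_high order_P
                frechet_le_start[OF \<alpha>(4)] in auto)
        qed
      qed
    qed
    moreover have "frechet_le D P T T Qc y2 y"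
    proof (rule frechet_le_wait_right)
      show "\<bar>P T - Qc t\<bar> \<le> D" if "y2 \<le> t" "t \<le> y" for t
        using HQ[of t] that y2 HT Qc_out[of t] by auto
    qed (fact y2)
    ultimately show ?thesis
      by (rule frechet_le_join)
  qed
qed

text \<open>Induction on the number of time steps \<open>\<kappa>\<close> from \<open>x1\<close> to
  \<open>T\<close>. With no step left, there is no \<open>a\<close> with \<open>x1 < a\<close> and
  \<open>a \<le> T - \<kappa>\<close>, so the recursive premise of \<open>match_step\<close> is
  vacuous.\<close>

lemma match_up_to:
  assumes \<kappa>: "\<kappa> > 0" "\<And>s s'. A \<le> s \<Longrightarrow> s \<le> s' \<Longrightarrow> s' \<le> B \<Longrightarrow> s' - s < \<kappa> \<Longrightarrow> P s' - P s < 2 * D"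
    and lam: "w - 3 * D \<le> lam"
  shows "T - x1 \<le> real N * \<kappa> \<Longrightarrow> reach lam T y \<Longrightarrow> frechet_le D P A T Qc C y"
proof (induction N arbitrary: T y)
  case (0 T y)
  show ?case
    by (rule match_step[OF \<kappa>(2) lam 0(2)]) (use 0(1) \<kappa>(1) in auto)
next
  case (Suc N T y)
  show ?case
    by (rule match_step[OF \<kappa>(2) lam Suc.prems(2)], assumption+, rule Suc.IH)
      (use Suc.prems(1) in \<open>auto simp: algebra_simps\<close>)
qed

lemma match_all: "frechet_le D P A B Qc C E"
proof -
  have start: "frechet_le D P A x1 Qc C t1"
    by (rule match_Qc_start[OF mAx]) simp
  obtain p where p: "x1 \<le> p" "p \<le> b" and max: "\<And>s. x1 \<le> s \<Longrightarrow> s \<le> b \<Longrightarrow> P s \<le> P p"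
    by (rule continuous_argmax[OF contP, of x1 b]) (use order_P in auto)
  have Qc_end: "frechet_le D P s B Qc t E" if "frechet_le D P s B Q t E" "t2 \<le> t" for s t
    by (rule frechet_le_cong[OF that(1)]) (use that(2) Qc_out in auto)
  show ?thesis
  proof (cases "P p \<le> z + D")
    case True
    have "frechet_le D P x1 b Qc t1 t2"
    proof (rule frechet_le_perform)
      show "\<bar>P s - Qc t1\<bar> \<le> D" if "x1 \<le> s" "s \<le> b" for s
        using max[OF that] P_bump[OF that] True Qc_in[of t1] order_Q by auto
      show "\<bar>P b - Qc t\<bar> \<le> D" if "t1 \<le> t" "t \<le> t2" for t
        using max[of b] P_bump[of b] True Qc_in[of t] order_P that by auto
      then show "\<bar>P s - Qc t2\<bar> \<le> D" if "b \<le> s" "s \<le> b" for s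
        using that order_Q by auto
    qed (use order_P order_Q in auto)
    then show ?thesis
      using start Qc_end[OF mbB] frechet_le_join by blast
  next
    case False
    define q where "q = P p - D"
    have q: "z < q" "q \<le> w"
      using False P_bump[OF p] by (auto simp: q_def)
    \<comment> \<open>The top of the edge at \<open>r\<close> is above \<open>w + D\<close> and
      lifts its partner on \<open>Q\<close> above \<open>w\<close>, so \<open>Q\<close> regains the
      height \<open>q\<close> after the peak.\<close>
    obtain \<rho> where \<rho>: "t2 \<le> \<rho>" "\<rho> \<le> E" "frechet_le D P b r Q t2 \<rho>" "frechet_le D P r B Q \<rho> E"
      by (rule frechet_le_split[OF mbB b_le_r edge(4)])
    have "Q \<rho> > w"
      using frechet_le_end[OF \<rho>(3)] Pr by auto
    have "continuous_on {t2..\<rho>} Q"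
      by (rule continuous_on_subset[OF contQ]) (use \<rho> order_Q in auto)
    then obtain y where y: "t2 \<le> y" "y \<le> \<rho>" "Q y = q"
        and y_first: "\<And>t. t2 \<le> t \<Longrightarrow> t \<le> y \<Longrightarrow> Q t \<le> q"
      by (rule continuous_first_hit[of t2 \<rho> Q q]) (use \<rho> q Qt \<open>Q \<rho> > w\<close> in auto)
    obtain x where x: "b \<le> x" "x \<le> r" "frechet_le D P b x Q t2 y" "frechet_le D P x r Q y \<rho>"
      by (rule frechet_le_split_right[OF \<rho>(3) y(1,2)])
    \<comment> \<open>The first low point, which fixes \<open>lam\<close> as \<open>P T\<close>. It
      is the minimum over the partners of the motion of \<open>Q\<close> from \<open>t2\<close> to
      \<open>y\<close>, so that motion never falls below \<open>P T - D\<close>.\<close>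
    obtain T where T: "b \<le> T" "T \<le> x" "\<And>s. b \<le> s \<Longrightarrow> s \<le> x \<Longrightarrow> P T \<le> P s"
      by (rule continuous_argmin[OF contP, of b x]) (use x order_P edge in auto)
    have P_late: "P s \<le> P p" if s: "b \<le> s" "s \<le> x" for s
    proof -
      obtain t where "t2 \<le> t" "t \<le> y" "\<bar>P s - Q t\<bar> \<le> D"
        by (rule frechet_le_matched[OF x(3) s])
      then show ?thesis
        using y_first[of t] by (auto simp: q_def)
    qed
    have P_late2: "P p - 2 * D \<le> P s" if "p \<le> s" "s \<le> x" for s
      using P_drop[of p s] that p x by auto
    have "w - D \<le> P p"
      using frechet_le_end[OF mxc] max[of c] order_P Qt by auto
    have "reach (P T) T y"
      unfolding reach_def
    proof (intro conjI allI impI)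
      show "P T - D \<le> Q t" if t: "t2 \<le> t \<and> t \<le> y" for t
      proof -
        obtain s where "b \<le> s" "s \<le> x" "\<bar>P s - Q t\<bar> \<le> D"
          by (rule frechet_le_matched_right[OF x(3), of t]) (use t in auto)
        then show ?thesis
          using T(3)[of s] by auto
      qed
      show "z - D \<le> P s" if s: "x1 \<le> s \<and> s \<le> T" for s
        using P_bump[of s] P_late2[of s] s T p q by (cases "s \<le> b") (auto simp: q_def)
      show "P s \<le> Q y + D" if s: "x1 \<le> s \<and> s \<le> T" for s
        using max[of s] P_late[of s] s T y by (cases "s \<le> b") (auto simp: q_def)
      show "Q y - D \<le> P T"
        using P_late2[of T] T p y by (auto simp: q_def)
    qed (use T x order_P y y_first \<rho> q in auto)
    moreover obtain \<kappa> where "\<kappa> > 0" "\<And>s s'. A \<le> s \<Longrightarrow> s \<le> s' \<Longrightarrow> s' \<le> B \<Longrightarrow> s' - s < \<kappa> \<Longrightarrow> P s' - P s < 2 * D"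
    proof -
      have "uniformly_continuous_on {A..B} P"
        using contP by (rule compact_uniformly_continuous) simp
      then obtain \<kappa> where \<kappa>: "\<kappa> > 0"
          "\<And>x x'. x \<in> {A..B} \<Longrightarrow> x' \<in> {A..B} \<Longrightarrow> dist x' x < \<kappa> \<Longrightarrow> dist (P x') (P x) < 2 * D"
        using D by (auto elim: uniformly_continuous_onE[of _ _ "2 * D"])
      have "P s' - P s < 2 * D" if "A \<le> s" "s \<le> s'" "s' \<le> B" "s' - s < \<kappa>" for s s'
        using \<kappa>(2)[of s s'] that by (auto simp: dist_real_def)
      with \<kappa>(1) show thesis
        by (rule that)
    qed
    moreover obtain N :: nat where "(T - x1) / \<kappa> \<le> real N"
      using real_arch_simple by blast
    then have "T - x1 \<le> real N * \<kappa>"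
      using \<open>\<kappa> > 0\<close> by (simp add: field_simps)
    \<comment> \<open>The maximum \<open>P p\<close> is at least the height \<open>w - D\<close>
      enforced opposite the top of the peak, and \<open>P_drop\<close> limits the loss after
      \<open>p\<close> to \<open>2 * D\<close>.\<close>
    moreover have "w - 3 * D \<le> P T"
      using \<open>w - D \<le> P p\<close> P_late2[of T] T p by auto
    ultimately have "frechet_le D P A T Qc C y"
      by (intro match_up_to[of \<kappa> "P T" T N y]) auto
    moreover have "frechet_le D P T x Qc y y"
    proof (rule frechet_le_wait)
      show "\<bar>P s - Qc y\<bar> \<le> D" if "T \<le> s" "s \<le> x" for s
        using P_late[of s] P_late2[of s] Qc_out[of y] y T p that by (auto simp: q_def)
    qed (use T in auto)
    moreover have "frechet_le D P x B Qc y E"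
      by (rule Qc_end[OF frechet_le_join[OF x(4) \<rho>(4)] y(1)])
    ultimately show ?thesis
      using frechet_le_join by blast
  qed
qed

end

section \<open>Signatures of functions\<close>

text \<open>
  Knots are indexed from \<open>0\<close> to \<open>m\<close>, so edge \<open>k\<close> joins \<open>x k\<close> to \<open>x (Suc k)\<close>. The range condition of a signature
  with only two vertices is the last clause, because both exceptions apply to its single edge.
\<close>

definition function_signature :: "real \<Rightarrow> (real \<Rightarrow> real) \<Rightarrow> (nat \<Rightarrow> real) \<Rightarrow> nat \<Rightarrow> bool" where
  "function_signature D P x m \<longleftrightarrow> 0 < m \<and> (\<forall>k<m. x k < x (Suc k)) \<and>
    (\<forall>k<m. (\<forall>s s'. x k \<le> s \<longrightarrow> s \<le> s' \<longrightarrow> s' \<le> x (Suc k) \<longrightarrow> P s \<le> P s' + 2 * D) \<or>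
           (\<forall>s s'. x k \<le> s \<longrightarrow> s \<le> s' \<longrightarrow> s' \<le> x (Suc k) \<longrightarrow> P s' \<le> P s + 2 * D)) \<and>
    (\<forall>k. Suc k < m \<longrightarrow> P (x (Suc k)) < min (P (x k)) (P (x (Suc (Suc k)))) \<or>
           max (P (x k)) (P (x (Suc (Suc k)))) < P (x (Suc k))) \<and>
    (\<forall>k<m. 1 < m \<longrightarrow> D < \<bar>P (x k) - P (x (Suc k))\<bar>) \<and>
    (\<forall>k. 0 < k \<and> Suc k < m \<longrightarrow> 2 * D < \<bar>P (x k) - P (x (Suc k))\<bar>) \<and>
    (\<forall>k<m. \<forall>s. x k \<le> s \<longrightarrow> s \<le> x (Suc k) \<longrightarrow>
       (min (P (x k)) (P (x (Suc k))) \<le> P s \<and> P s \<le> max (P (x k)) (P (x (Suc k)))) \<or>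
       (k = 0 \<and> \<bar>P s - P (x 0)\<bar> \<le> D) \<or> (Suc k = m \<and> \<bar>P s - P (x m)\<bar> \<le> D))"

definition avoids_signature ::
    "real \<Rightarrow> (real \<Rightarrow> real) \<Rightarrow> (nat \<Rightarrow> real) \<Rightarrow> nat \<Rightarrow> real \<Rightarrow> bool" where
  "avoids_signature D P x m w \<longleftrightarrow> 3 * D < \<bar>w - P (x 0)\<bar> \<and> 3 * D < \<bar>w - P (x m)\<bar> \<and>
    (\<forall>k. 0 < k \<and> k < m \<longrightarrow> D < \<bar>w - P (x k)\<bar>)"

section \<open>Negation and time reversal of signatures\<close>

lemma function_signature_minus:
  assumes "function_signature D P x m"
  shows "function_signature D (\<lambda>s. - P s) x m"
  unfolding function_signature_def
proof (intro conjI allI impI)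
  show "0 < m" "\<And>k. k < m \<Longrightarrow> x k < x (Suc k)"
    using assms by (auto simp: function_signature_def)
  show "(\<forall>s s'. x k \<le> s \<longrightarrow> s \<le> s' \<longrightarrow> s' \<le> x (Suc k) \<longrightarrow> - P s \<le> - P s' + 2 * D) \<or>
        (\<forall>s s'. x k \<le> s \<longrightarrow> s \<le> s' \<longrightarrow> s' \<le> x (Suc k) \<longrightarrow> - P s' \<le> - P s + 2 * D)" if "k < m" for k
  proof -
    have "(\<forall>s s'. x k \<le> s \<longrightarrow> s \<le> s' \<longrightarrow> s' \<le> x (Suc k) \<longrightarrow> P s \<le> P s' + 2 * D) \<or>
        (\<forall>s s'. x k \<le> s \<longrightarrow> s \<le> s' \<longrightarrow> s' \<le> x (Suc k) \<longrightarrow> P s' \<le> P s + 2 * D)"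
      using assms that unfolding function_signature_def by blast
    moreover have "a \<le> b + 2 * D \<longleftrightarrow> - b \<le> - a + 2 * D" for a b :: real
      by auto
    ultimately show ?thesis
      by metis
  qed
  show "- P (x (Suc k)) < min (- P (x k)) (- P (x (Suc (Suc k)))) \<or>
        max (- P (x k)) (- P (x (Suc (Suc k)))) < - P (x (Suc k))" if "Suc k < m" for k
    using assms that unfolding function_signature_def by fastforce
  show "D < \<bar>- P (x k) - - P (x (Suc k))\<bar>" if "k < m" "1 < m" for k
    using assms that unfolding function_signature_def by fastforce
  show "2 * D < \<bar>- P (x k) - - P (x (Suc k))\<bar>" if "0 < k \<and> Suc k < m" for k
    using assms that unfolding function_signature_def by fastforce
  show "(min (- P (x k)) (- P (x (Suc k))) \<le> - P s \<and> - P s \<le> max (- P (x k)) (- P (x (Suc k)))) \<or>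
       (k = 0 \<and> \<bar>- P s - - P (x 0)\<bar> \<le> D) \<or> (Suc k = m \<and> \<bar>- P s - - P (x m)\<bar> \<le> D)"
    if "k < m" "x k \<le> s" "s \<le> x (Suc k)" for k s
  proof -
    have "(min (P (x k)) (P (x (Suc k))) \<le> P s \<and> P s \<le> max (P (x k)) (P (x (Suc k)))) \<or>
       (k = 0 \<and> \<bar>P s - P (x 0)\<bar> \<le> D) \<or> (Suc k = m \<and> \<bar>P s - P (x m)\<bar> \<le> D)"
      using assms that unfolding function_signature_def by blast
    moreover have "min (- a) (- b) \<le> - v \<and> - v \<le> max (- a) (- b) \<longleftrightarrow> min a b \<le> v \<and> v \<le> max a b"
        "\<bar>- a - - b\<bar> = \<bar>a - b\<bar>" for a b v :: real
      by auto
    ultimately show ?thesis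
      by simp
  qed
qed

lemma function_signature_reverse:
  assumes "function_signature D P x m"
  shows "function_signature D (\<lambda>s. P (- s)) (\<lambda>k. - x (m - k)) m"
  unfolding function_signature_def
proof (intro conjI allI impI)
  \<comment> \<open>Reversal turns edge \<open>k\<close> into edge \<open>m - Suc k\<close> with its
    ends exchanged. Writing \<open>m - k\<close> as a successor gives the right end of that edge the
    form used in the definition.\<close>
  have step: "m - k = Suc (m - Suc k)" if "k < m" for k
    using that by simp
  note sig = assms[unfolded function_signature_def]
  show "0 < m"
    using sig by auto
  show "- x (m - k) < - x (m - Suc k)" if "k < m" for k
    using sig that by (simp add: step)
  show "(\<forall>s s'. - x (m - k) \<le> s \<longrightarrow> s \<le> s' \<longrightarrow> s' \<le> - x (m - Suc k) \<longrightarrow> P (- s) \<le> P (- s') + 2 * D) \<or>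
        (\<forall>s s'. - x (m - k) \<le> s \<longrightarrow> s \<le> s' \<longrightarrow> s' \<le> - x (m - Suc k) \<longrightarrow> P (- s') \<le> P (- s) + 2 * D)"
    (is "?inc \<or> ?dec") if k: "k < m" for k
  proof -
    have "m - Suc k < m"
      using k by simp
    then consider
        "\<And>s s'. x (m - Suc k) \<le> s \<Longrightarrow> s \<le> s' \<Longrightarrow> s' \<le> x (m - k) \<Longrightarrow> P s \<le> P s' + 2 * D" |
        "\<And>s s'. x (m - Suc k) \<le> s \<Longrightarrow> s \<le> s' \<Longrightarrow> s' \<le> x (m - k) \<Longrightarrow> P s' \<le> P s + 2 * D"
      using sig unfolding step[OF k] by blast
    then show ?thesis
    proof cases
      case 1
      then have ?dec
        by auto
      then show ?thesis ..
    next
      case 2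
      then have ?inc
        by auto
      then show ?thesis ..
    qed
  qed
  show "P (- (- x (m - Suc k))) < min (P (- (- x (m - k)))) (P (- (- x (m - Suc (Suc k))))) \<or>
        max (P (- (- x (m - k)))) (P (- (- x (m - Suc (Suc k))))) < P (- (- x (m - Suc k)))" if "Suc k < m" for k
  proof -
    have eqs: "m - k = Suc (Suc (m - Suc (Suc k)))" "m - Suc k = Suc (m - Suc (Suc k))"
      and "Suc (m - Suc (Suc k)) < m"
      using that by simp_all
    then show ?thesis
      using sig by (simp add: min.commute max.commute)
  qed
  show "D < \<bar>P (- (- x (m - k))) - P (- (- x (m - Suc k)))\<bar>" if "k < m" "1 < m" for k
  proof -
    have "m - Suc k < m"
      using that by simp
    then have "D < \<bar>P (x (m - Suc k)) - P (x (Suc (m - Suc k)))\<bar>"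
      using sig that by blast
    then show ?thesis
      using that by (simp add: step abs_minus_commute)
  qed
  show "2 * D < \<bar>P (- (- x (m - k))) - P (- (- x (m - Suc k)))\<bar>" if "0 < k \<and> Suc k < m" for k
  proof -
    have "0 < m - Suc k" "Suc (m - Suc k) < m" "k < m"
      using that by auto
    then have "2 * D < \<bar>P (x (m - Suc k)) - P (x (Suc (m - Suc k)))\<bar>"
      using sig by blast
    then show ?thesis
      using \<open>k < m\<close> by (simp add: step abs_minus_commute)
  qed
  show "(min (P (- (- x (m - k)))) (P (- (- x (m - Suc k)))) \<le> P (- s) \<and>
        P (- s) \<le> max (P (- (- x (m - k)))) (P (- (- x (m - Suc k))))) \<or>
       (k = 0 \<and> \<bar>P (- s) - P (- (- x (m - 0)))\<bar> \<le> D) \<or>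
       (Suc k = m \<and> \<bar>P (- s) - P (- (- x (m - m)))\<bar> \<le> D)"
    if k: "k < m" and s: "- x (m - k) \<le> s" "s \<le> - x (m - Suc k)" for k s
  proof -
    have "m - Suc k < m" "x (m - Suc k) \<le> - s" "- s \<le> x (Suc (m - Suc k))"
      using k s by (simp_all flip: step[OF k])
    then have "(min (P (x (m - Suc k))) (P (x (Suc (m - Suc k)))) \<le> P (- s) \<and>
         P (- s) \<le> max (P (x (m - Suc k))) (P (x (Suc (m - Suc k))))) \<or>
       (m - Suc k = 0 \<and> \<bar>P (- s) - P (x 0)\<bar> \<le> D) \<or>
       (Suc (m - Suc k) = m \<and> \<bar>P (- s) - P (x m)\<bar> \<le> D)"
      using sig by blast
    moreover have "m - Suc k = 0 \<longleftrightarrow> Suc k = m" "Suc (m - Suc k) = m \<longleftrightarrow> k = 0"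
      using k by auto
    ultimately show ?thesis
      unfolding step[OF k] by (simp add: min.commute max.commute) blast
  qed
qed

lemma avoids_signature_minus:
  assumes "avoids_signature D P x m w"
  shows "avoids_signature D (\<lambda>s. - P s) x m (- w)"
proof -
  have *: "\<bar>- w - - y\<bar> = \<bar>w - y\<bar>" for y
    by simp
  show ?thesis
    using assms unfolding avoids_signature_def * .
qed

lemma avoids_signature_reverse:
  assumes "avoids_signature D P x m w"
  shows "avoids_signature D (\<lambda>s. P (- s)) (\<lambda>k. - x (m - k)) m w"
  using assms by (simp add: avoids_signature_def)

section \<open>The signature edge opposite the peak\<close>

lemma function_signature_mono:
  assumes "function_signature D P x m" "i \<le> j" "j \<le> m"
  shows "x i \<le> x j"
  using assms(2,3)
proof (induction j rule: dec_induct)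
  case (step j)
  have "x j < x (Suc j)"
    using assms(1) step.prems by (auto simp: function_signature_def)
  then show ?case
    using step by auto
qed simp

lemma function_signature_edge_exists:
  assumes "function_signature D P x m" "x 0 \<le> c" "c \<le> x m"
  obtains k where "k < m" "x k \<le> c" "c \<le> x (Suc k)"
proof -
  define k where "k = (LEAST k. c \<le> x (Suc k))"
  have "0 < m"
    using assms(1) by (simp add: function_signature_def)
  then have "c \<le> x (Suc (m - 1))"
    using assms(3) by simp
  then have 1: "c \<le> x (Suc k)" "k \<le> m - 1"
    unfolding k_def by (rule LeastI, rule Least_le)
  have "x k \<le> c"
  proof (cases k)
    case (Suc j)
    then have "\<not> c \<le> x (Suc j)"
      unfolding k_def by (intro not_less_Least) auto
    then show ?thesis
      using Suc by simp
  qed (use assms in simp)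
  with 1 \<open>0 < m\<close> show thesis
    by (intro that[of k]) auto
qed

text \<open>Supplies the edge assumptions of \<open>matched_bump\<close>. \<open>P c\<close> is
  within \<open>D\<close> of \<open>w\<close> and between the end values of the edge, which are
  farther than \<open>D\<close> from \<open>w\<close>. So they lie on both sides of
  \<open>w\<close>, and a rise of more than \<open>2 * D\<close> rules out the decreasing kind of
  edge.\<close>

lemma signature_increasing_edge:
  assumes D: "D > 0" and sig: "function_signature D P x m" and avoid: "avoids_signature D P x m w"
    and k: "k < m" and c: "x k \<le> c" "c \<le> x (Suc k)" "\<bar>P c - w\<bar> \<le> D"
    and up: "P (x k) \<le> P (x (Suc k))"
  shows "\<And>s s'. x k \<le> s \<Longrightarrow> s \<le> s' \<Longrightarrow> s' \<le> x (Suc k) \<Longrightarrow> P s \<le> P s' + 2 * D"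
    and "P (x (Suc k)) > w + D"
    and "(x k = x 0 \<and> P (x 0) < w - 3 * D) \<or>
      (\<exists>l0. x 0 \<le> l0 \<and> l0 \<le> x k \<and> (\<forall>s. l0 \<le> s \<longrightarrow> s \<le> x (Suc k) \<longrightarrow> P (x k) \<le> P s) \<and>
        (P l0 > P (x k) + 2 * D \<or> (l0 = x 0 \<and> \<bar>w - P (x 0)\<bar> > 3 * D)))"
proof -
  have range: "(min (P (x k)) (P (x (Suc k))) \<le> P s \<and> P s \<le> max (P (x k)) (P (x (Suc k)))) \<or>
       (k = 0 \<and> \<bar>P s - P (x 0)\<bar> \<le> D) \<or> (Suc k = m \<and> \<bar>P s - P (x m)\<bar> \<le> D)"
    if "k < m" "x k \<le> s" "s \<le> x (Suc k)" for k s
    using sig that unfolding function_signature_def by blast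
  have avoid0: "3 * D < \<bar>w - P (x 0)\<bar>" and avoidm: "3 * D < \<bar>w - P (x m)\<bar>"
    and avoid1: "\<And>k. 0 < k \<Longrightarrow> k < m \<Longrightarrow> D < \<bar>w - P (x k)\<bar>"
    using avoid by (auto simp: avoids_signature_def)
  have avoid: "D < \<bar>w - P (x j)\<bar>" if "j \<le> m" for j
    using avoid0 avoidm avoid1[of j] that D by (cases "j = 0"; cases "j = m") auto
  \<comment> \<open>The balls around the end vertices cannot contain \<open>P c\<close>, as
    \<open>w\<close> is more than \<open>3 * D\<close> away from their centres.\<close>
  have "P (x k) \<le> P c \<and> P c \<le> P (x (Suc k))"
    using range[OF k c(1,2)] c(3) avoid0 avoidm up by auto
  then have w: "P (x k) + D < w" "w < P (x (Suc k)) - D"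
    using avoid[of k] avoid[of "Suc k"] c(3) k by auto
  then have "\<not> P (x (Suc k)) \<le> P (x k) + 2 * D" "x k \<le> x (Suc k)"
    using c by auto
  then have "\<not> (\<forall>s s'. x k \<le> s \<longrightarrow> s \<le> s' \<longrightarrow> s' \<le> x (Suc k) \<longrightarrow> P s' \<le> P s + 2 * D)"
    by blast
  then show "P s \<le> P s' + 2 * D" if "x k \<le> s" "s \<le> s'" "s' \<le> x (Suc k)" for s s'
    using sig k that unfolding function_signature_def by blast
  show "P (x (Suc k)) > w + D"
    using w by simp
  show "(x k = x 0 \<and> P (x 0) < w - 3 * D) \<or>
      (\<exists>l0. x 0 \<le> l0 \<and> l0 \<le> x k \<and> (\<forall>s. l0 \<le> s \<longrightarrow> s \<le> x (Suc k) \<longrightarrow> P (x k) \<le> P s) \<and>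
        (P l0 > P (x k) + 2 * D \<or> (l0 = x 0 \<and> \<bar>w - P (x 0)\<bar> > 3 * D)))"
  proof (cases k)
    case 0
    then show ?thesis
      using avoid0 w by auto
  next
    \<comment> \<open>The previous knot serves as \<open>l0\<close>. The vertex at
      \<open>x k\<close> is a valley, and the balls allowed at the ends of the signature stay above
      it because every edge is longer than \<open>D\<close>.\<close>
    case (Suc j)
    have "P (x k) < min (P (x j)) (P (x (Suc k))) \<or> max (P (x j)) (P (x (Suc k))) < P (x k)"
      using sig k unfolding function_signature_def Suc by blast
    then have low: "P (x k) < P (x j)"
      using w D by auto
    have long: "D < \<bar>P (x i) - P (x (Suc i))\<bar>" if "i < m" for i
      using sig that k Suc unfolding function_signature_def by auto
    have "P (x k) \<le> P s" if s: "x j \<le> s" "s \<le> x (Suc k)" for s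
    proof (cases "s \<le> x k")
      case True
      then show ?thesis
        using range[of j s] long[of j] low s k Suc by auto
    next
      case False
      then show ?thesis
        using range[of k s] long[of k] w s k Suc D by auto
    qed
    \<comment> \<open>An inner edge falls by more than \<open>2 * D\<close>. The first edge is only
      known to be longer than \<open>D\<close>; there the radius \<open>3 * D\<close> around the
      first vertex takes over.\<close>
    moreover have "P (x j) > P (x k) + 2 * D \<or> x j = x 0 \<and> \<bar>w - P (x 0)\<bar> > 3 * D"
    proof (cases "j = 0")
      case False
      then have "2 * D < \<bar>P (x j) - P (x (Suc j))\<bar>"
        using sig k Suc unfolding function_signature_def by auto
      then show ?thesis
        using low Suc by auto
    qed (use avoid0 in auto)
    moreover have "x 0 \<le> x j" "x j \<le> x k"
      using function_signature_mono[OF sig] k Suc by auto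
    ultimately show ?thesis
      by blast
  qed
qed

section \<open>From cutting a peak to removing a vertex\<close>

lemma frechet_le_cut_peak_increasing:
  assumes D: "D > 0" and sig: "function_signature D P x m" and avoid: "avoids_signature D P x m (Q sg)"
    and cont: "continuous_on {x 0..x m} P" "continuous_on {C..E} Q"
    and left: "frechet_le D P (x 0) c Q C sg" and right: "frechet_le D P c (x m) Q sg E"
    and order: "C \<le> t1" "t1 \<le> sg" "sg \<le> t2" "t2 \<le> E" and Qt: "Q t1 = z" "Q t2 = z"
    and Qup: "\<And>t t'. t1 \<le> t \<Longrightarrow> t \<le> t' \<Longrightarrow> t' \<le> sg \<Longrightarrow> Q t \<le> Q t'"
    and Qdown: "\<And>t t'. sg \<le> t \<Longrightarrow> t \<le> t' \<Longrightarrow> t' \<le> t2 \<Longrightarrow> Q t' \<le> Q t"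
    and Qc_in: "\<And>t. t1 \<le> t \<Longrightarrow> t \<le> t2 \<Longrightarrow> Qc t = z"
    and Qc_out: "\<And>t. t \<le> t1 \<or> t2 \<le> t \<Longrightarrow> Qc t = Q t"
    and k: "k < m" "x k \<le> c" "c \<le> x (Suc k)" "P (x k) \<le> P (x (Suc k))"
  shows "frechet_le D P (x 0) (x m) Qc C E"
proof -
  obtain x1 where x1: "frechet_le D P (x 0) x1 Q C t1" "frechet_le D P x1 c Q t1 sg"
    by (rule frechet_le_split_right[OF left order(1,2)])
  obtain b where b: "frechet_le D P c b Q sg t2" "frechet_le D P b (x m) Q t2 E"
    by (rule frechet_le_split_right[OF right order(3,4)])
  note edge = signature_increasing_edge[OF D sig avoid k(1-3) frechet_le_end[OF left] k(4)]
  interpret matched_bump D P Q Qc "x 0" "x m" C E x1 c b t1 sg t2 z "Q sg" "x k" "x (Suc k)"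
  proof
    show "x 0 \<le> x k" "x (Suc k) \<le> x m"
      using function_signature_mono[OF sig] k by auto
  qed (use assms x1 b edge in auto)
  show ?thesis
    by (rule match_all)
qed

lemma frechet_le_cut_peak:
  assumes D: "D > 0" and sig: "function_signature D P x m" and avoid: "avoids_signature D P x m (Q sg)"
    and cont: "continuous_on {x 0..x m} P" "continuous_on {C..E} Q"
    and match: "frechet_le D P (x 0) (x m) Q C E"
    and order: "C \<le> t1" "t1 \<le> sg" "sg \<le> t2" "t2 \<le> E" and Qt: "Q t1 = z" "Q t2 = z"
    and Qup: "\<And>t t'. t1 \<le> t \<Longrightarrow> t \<le> t' \<Longrightarrow> t' \<le> sg \<Longrightarrow> Q t \<le> Q t'"
    and Qdown: "\<And>t t'. sg \<le> t \<Longrightarrow> t \<le> t' \<Longrightarrow> t' \<le> t2 \<Longrightarrow> Q t' \<le> Q t"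
    and Qc_in: "\<And>t. t1 \<le> t \<Longrightarrow> t \<le> t2 \<Longrightarrow> Qc t = z"
    and Qc_out: "\<And>t. t \<le> t1 \<or> t2 \<le> t \<Longrightarrow> Qc t = Q t"
  shows "frechet_le D P (x 0) (x m) Qc C E"
proof -
  obtain c where c: "x 0 \<le> c" "c \<le> x m" "frechet_le D P (x 0) c Q C sg" "frechet_le D P c (x m) Q sg E"
    by (rule frechet_le_split_right[OF match, of sg]) (use order in auto)
  obtain k where k: "k < m" "x k \<le> c" "c \<le> x (Suc k)"
    by (rule function_signature_edge_exists[OF sig c(1,2)])
  show ?thesis
  proof (cases "P (x k) \<le> P (x (Suc k))")
    case True
    show ?thesis
      by (rule frechet_le_cut_peak_increasing[OF D sig avoid cont c(3,4) order Qt _ _ _ _ k True])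
        (use Qup Qdown Qc_in Qc_out in auto)
  next
    case False
    \<comment> \<open>Time reversal makes the edge increasing. Its index becomes
      \<open>m - Suc k\<close>, and the two feet \<open>t1\<close> and \<open>t2\<close> of the peak
      trade places.\<close>
    let ?P = "\<lambda>s. P (- s)" and ?Q = "\<lambda>t. Q (- t)" and ?Qc = "\<lambda>t. Qc (- t)"
    let ?x = "\<lambda>k. - x (m - k)"
    have "frechet_le D ?P (?x 0) (?x m) ?Qc (- E) (- C)"
    proof (rule frechet_le_cut_peak_increasing[where k = "m - Suc k" and c = "- c" and sg = "- sg"
          and ?t1.0 = "- t2" and ?t2.0 = "- t1" and z = z and Q = ?Q])
      show "function_signature D ?P ?x m" "avoids_signature D ?P ?x m (?Q (- sg))"
        using function_signature_reverse[OF sig] avoids_signature_reverse[OF avoid] by auto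
      show "continuous_on {?x 0..?x m} ?P" "continuous_on {- E..- C} ?Q"
        by (intro continuous_on_compose2[OF cont(1)] continuous_on_compose2[OF cont(2)] continuous_intros; auto)+
      show "frechet_le D ?P (?x 0) (- c) ?Q (- E) (- sg)" "frechet_le D ?P (- c) (?x m) ?Q (- sg) (- C)"
        using frechet_le_reverse[OF c(4)] frechet_le_reverse[OF c(3)] by auto
      have "m - (m - Suc k) = Suc k" "m - Suc (m - Suc k) = k"
        using k by auto
      then show "?x (m - Suc k) \<le> - c" "- c \<le> ?x (Suc (m - Suc k))" "?P (?x (m - Suc k)) \<le> ?P (?x (Suc (m - Suc k)))"
        using k False by auto
    qed (use D order Qt k Qup Qdown Qc_in Qc_out in auto)
    from frechet_le_reverse[OF this] show ?thesis
      by simp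
  qed
qed

text \<open>Only the timing of the monotone piece changes, and everything after it is shifted by
  \<open>\<beta>' - \<beta>\<close>. For the removal of a vertex this shift is
  \<open>-1\<close>.\<close>

lemma frechet_le_contract:
  assumes match: "frechet_le D P A B Qc C E" and order: "C \<le> \<alpha>" "\<alpha> \<le> \<beta>" "\<beta> \<le> E" "\<alpha> < \<beta>'"
    and cont: "continuous_on {\<alpha>..\<beta>} Qc"
    and mono: "mono_on {\<alpha>..\<beta>} Qc \<or> antimono_on {\<alpha>..\<beta>} Qc"
    and before: "\<And>t. C \<le> t \<Longrightarrow> t \<le> \<alpha> \<Longrightarrow> Q2 t = Qc t"
    and lin: "\<And>x. 0 \<le> x \<Longrightarrow> x \<le> 1 \<Longrightarrow> Q2 (\<alpha> + x * (\<beta>' - \<alpha>)) = (1 - x) * Qc \<alpha> + x * Qc \<beta>"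
    and after: "\<And>t. \<beta> \<le> t \<Longrightarrow> t \<le> E \<Longrightarrow> Q2 (t + (\<beta>' - \<beta>)) = Qc t"
  shows "frechet_le D P A B Q2 C (E + (\<beta>' - \<beta>))"
proof -
  have "\<alpha> \<le> E"
    using order by simp
  obtain a where a: "frechet_le D P A a Qc C \<alpha>" "frechet_le D P a B Qc \<alpha> E"
    by (rule frechet_le_split_right[OF match order(1) \<open>\<alpha> \<le> E\<close>])
  obtain b where b: "frechet_le D P a b Qc \<alpha> \<beta>" "frechet_le D P b B Qc \<beta> E"
    by (rule frechet_le_split_right[OF a(2) order(2,3)])
  have "frechet_le D P A a Q2 C \<alpha>"
    by (rule frechet_le_cong[OF a(1) before])
  moreover have "frechet_le D P a b Q2 \<alpha> \<beta>'"
    by (rule frechet_le_monotone_to_linear[OF b(1) cont mono order(4) lin])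
  moreover have "frechet_le D P b B Q2 (\<beta> + (\<beta>' - \<beta>)) (E + (\<beta>' - \<beta>))"
    by (rule frechet_le_reparam[OF b(2), of "\<lambda>t. t + (\<beta>' - \<beta>)"])
      (auto intro!: continuous_intros mono_onI after)
  ultimately show ?thesis
    by (auto intro: frechet_le_join)
qed

lemma frechet_le_remove_peak:
  assumes D: "D > 0" and sig: "function_signature D P x m" and avoid: "avoids_signature D P x m (Q \<sigma>)"
    and cont: "continuous_on {x 0..x m} P" "continuous_on {C..E} Q"
    and match: "frechet_le D P (x 0) (x m) Q C E"
    and order: "C \<le> \<alpha>" "\<alpha> \<le> \<sigma>" "\<sigma> \<le> \<beta>" "\<beta> \<le> E" "\<alpha> < \<beta>'"
    and up: "mono_on {\<alpha>..\<sigma>} Q" and down: "antimono_on {\<sigma>..\<beta>} Q"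
    and before: "\<And>t. C \<le> t \<Longrightarrow> t \<le> \<alpha> \<Longrightarrow> Q2 t = Q t"
    and lin: "\<And>x. 0 \<le> x \<Longrightarrow> x \<le> 1 \<Longrightarrow> Q2 (\<alpha> + x * (\<beta>' - \<alpha>)) = (1 - x) * Q \<alpha> + x * Q \<beta>"
    and after: "\<And>t. \<beta> \<le> t \<Longrightarrow> t \<le> E \<Longrightarrow> Q2 (t + (\<beta>' - \<beta>)) = Q t"
  shows "frechet_le D P (x 0) (x m) Q2 C (E + (\<beta>' - \<beta>))"
proof -
  \<comment> \<open>Cutting at the higher neighbour flattens the whole flank on its side, so the cut
    curve is monotone between the neighbours and differs from the new edge only in timing. The cut
    is confined to \<open>[\<alpha>, \<beta>]\<close>, since \<open>Q\<close> may exceed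
    \<open>z\<close> elsewhere.\<close>
  define z where "z = max (Q \<alpha>) (Q \<beta>)"
  define Qc where "Qc t = (if \<alpha> \<le> t \<and> t \<le> \<beta> then min (Q t) z else Q t)" for t
  have up: "Q t \<le> Q t'" if "\<alpha> \<le> t" "t \<le> t'" "t' \<le> \<sigma>" for t t'
    using mono_onD[OF up, of t t'] that by auto
  have down: "Q t' \<le> Q t" if "\<sigma> \<le> t" "t \<le> t'" "t' \<le> \<beta>" for t t'
    using monotone_onD[OF down, of t t'] that by auto
  have sub: "continuous_on {u..v} Q" if "C \<le> u" "v \<le> E" for u v
    by (rule continuous_on_subset[OF cont(2)]) (use that in auto)
  have z: "Q \<alpha> \<le> z" "Q \<beta> \<le> z" "z \<le> Q \<sigma>"
    using up[of \<alpha> \<sigma>] down[of \<sigma> \<beta>] order by (auto simp: z_def)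
  obtain t1 where t1: "\<alpha> \<le> t1" "t1 \<le> \<sigma>" "Q t1 = z"
    using IVT'[of Q \<alpha> z \<sigma>] z order sub[of \<alpha> \<sigma>] by auto
  obtain t2 where t2: "\<sigma> \<le> t2" "t2 \<le> \<beta>" "Q t2 = z"
    using IVT2'[of Q \<beta> z \<sigma>] z order sub[of \<sigma> \<beta>] by auto
  have "frechet_le D P (x 0) (x m) Qc C E"
  proof (rule frechet_le_cut_peak[OF D sig avoid cont match _ t1(2) t2(1) _ t1(3) t2(3)])
    show "Qc t = z" if "t1 \<le> t" "t \<le> t2" for t
      using up[of t1 t] down[of t t2] that t1 t2 by (cases "t \<le> \<sigma>") (auto simp: Qc_def)
    show "Qc t = Q t" if "t \<le> t1 \<or> t2 \<le> t" for t
      using up[of t t1] down[of t2 t] that t1 t2 by (auto simp: Qc_def)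
  qed (use up down order t1 t2 in auto)
  moreover have "continuous_on {\<alpha>..\<beta>} Qc"
  proof -
    have "continuous_on {\<alpha>..\<beta>} (\<lambda>t. min (Q t) z)"
      using order by (intro continuous_intros sub) auto
    then show ?thesis
      by (rule continuous_on_eq) (auto simp: Qc_def)
  qed
  moreover have "mono_on {\<alpha>..\<beta>} Qc \<or> antimono_on {\<alpha>..\<beta>} Qc"
  proof (cases "Q \<alpha> \<le> Q \<beta>")
    case True
    have "Qc t \<le> Qc t'" if "\<alpha> \<le> t" "t \<le> t'" "t' \<le> \<beta>" for t t'
    proof (cases "t' \<le> \<sigma>")
      case False
      then have "z \<le> Q t'"
        using down[of t' \<beta>] that True by (auto simp: z_def)
      then show ?thesis
        using that by (auto simp: Qc_def)
    qed (use up[of t t'] that in \<open>auto simp: Qc_def\<close>)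
    then show ?thesis
      by (auto intro!: monotone_onI)
  next
    case False
    have "Qc t' \<le> Qc t" if "\<alpha> \<le> t" "t \<le> t'" "t' \<le> \<beta>" for t t'
    proof (cases "t \<le> \<sigma>")
      case True
      then have "z \<le> Q t"
        using up[of \<alpha> t] that False by (auto simp: z_def)
      then show ?thesis
        using that by (auto simp: Qc_def)
    qed (use down[of t t'] that in \<open>auto simp: Qc_def\<close>)
    then show ?thesis
      by (auto intro!: monotone_onI)
  qed
  moreover have "Qc t = Q t" if "t \<le> \<alpha> \<or> \<beta> \<le> t" for t
    using that z by (auto simp: Qc_def)
  ultimately show ?thesis
    using order before lin after by (intro frechet_le_contract[of D P "x 0" "x m" Qc C E \<alpha> \<beta> \<beta>' Q2]) auto
qed

text \<open>If \<open>Q\<close> is monotone across \<open>\<sigma>\<close>, the removal affects only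
  the timing. A valley is a peak of the negated curves.\<close>

lemma frechet_le_remove_between:
  assumes D: "D > 0" and sig: "function_signature D P x m" and avoid: "avoids_signature D P x m (Q \<sigma>)"
    and cont: "continuous_on {x 0..x m} P" "continuous_on {C..E} Q"
    and match: "frechet_le D P (x 0) (x m) Q C E"
    and order: "C \<le> \<alpha>" "\<alpha> \<le> \<sigma>" "\<sigma> \<le> \<beta>" "\<beta> \<le> E" "\<alpha> < \<beta>'"
    and mono1: "mono_on {\<alpha>..\<sigma>} Q \<or> antimono_on {\<alpha>..\<sigma>} Q"
    and mono2: "mono_on {\<sigma>..\<beta>} Q \<or> antimono_on {\<sigma>..\<beta>} Q"
    and before: "\<And>t. C \<le> t \<Longrightarrow> t \<le> \<alpha> \<Longrightarrow> Q2 t = Q t"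
    and lin: "\<And>x. 0 \<le> x \<Longrightarrow> x \<le> 1 \<Longrightarrow> Q2 (\<alpha> + x * (\<beta>' - \<alpha>)) = (1 - x) * Q \<alpha> + x * Q \<beta>"
    and after: "\<And>t. \<beta> \<le> t \<Longrightarrow> t \<le> E \<Longrightarrow> Q2 (t + (\<beta>' - \<beta>)) = Q t"
  shows "frechet_le D P (x 0) (x m) Q2 C (E + (\<beta>' - \<beta>))"
proof -
  have contract: ?thesis if "mono_on {\<alpha>..\<beta>} Q \<or> antimono_on {\<alpha>..\<beta>} Q"
  proof (rule frechet_le_contract[OF match _ _ _ _ _ that])
    show "continuous_on {\<alpha>..\<beta>} Q"
      by (rule continuous_on_subset[OF cont(2)]) (use order in auto)
  qed (use order before lin after in auto)
  from mono1 mono2 consider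
      "mono_on {\<alpha>..\<sigma>} Q" "mono_on {\<sigma>..\<beta>} Q" | "antimono_on {\<alpha>..\<sigma>} Q" "antimono_on {\<sigma>..\<beta>} Q" |
      "mono_on {\<alpha>..\<sigma>} Q" "antimono_on {\<sigma>..\<beta>} Q" | "antimono_on {\<alpha>..\<sigma>} Q" "mono_on {\<sigma>..\<beta>} Q"
    by blast
  then show ?thesis
  proof cases
    case 1
    have "Q t \<le> Q t'" if "\<alpha> \<le> t" "t \<le> t'" "t' \<le> \<beta>" for t t'
      using mono_onD[OF 1(1), of t t'] mono_onD[OF 1(2), of t t'] mono_onD[OF 1(1), of t \<sigma>]
        mono_onD[OF 1(2), of \<sigma> t'] that order by force
    then have "mono_on {\<alpha>..\<beta>} Q"
      by (auto intro!: monotone_onI)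
    then show ?thesis
      using contract by blast
  next
    case 2
    have "Q t' \<le> Q t" if "\<alpha> \<le> t" "t \<le> t'" "t' \<le> \<beta>" for t t'
      using monotone_onD[OF 2(1), of t t'] monotone_onD[OF 2(2), of t t'] monotone_onD[OF 2(1), of t \<sigma>]
        monotone_onD[OF 2(2), of \<sigma> t'] that order by force
    then have "antimono_on {\<alpha>..\<beta>} Q"
      by (auto intro!: monotone_onI)
    then show ?thesis
      using contract by blast
  next
    case 3
    then show ?thesis
      using frechet_le_remove_peak[OF D sig avoid cont match order _ _ before lin after] by blast
  next
    case 4
    have "frechet_le D (\<lambda>s. - P s) (x 0) (x m) (\<lambda>t. - Q2 t) C (E + (\<beta>' - \<beta>))"
    proof (rule frechet_le_remove_peak[OF D function_signature_minus[OF sig] _ _ _ frechet_le_minus[OF match] order])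
      show "avoids_signature D (\<lambda>s. - P s) x m (- Q \<sigma>)"
        by (rule avoids_signature_minus[OF avoid])
      show "mono_on {\<alpha>..\<sigma>} (\<lambda>t. - Q t)" "antimono_on {\<sigma>..\<beta>} (\<lambda>t. - Q t)"
        using 4 by (auto simp: monotone_on_def)
    qed (use before lin after cont in \<open>auto intro!: continuous_intros simp: algebra_simps\<close>)
    from frechet_le_minus[OF this] show ?thesis
      by simp
  qed
qed

section \<open>Curves of time series\<close>

text \<open>The case \<open>a = 1\<close>, where the floor already jumps to the next vertex, is
  included so that edges can be handled as closed intervals.\<close>

lemma curve_segment:
  assumes "0 \<le> a" "a \<le> 1"
  shows "curve P (real i + a) = (1 - a) * vertex P i + a * vertex P (i + 1)"
proof (cases "a = 1")
  case True
  have "curve P (real k) = vertex P k" for k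
    by (simp add: curve_def frac_def)
  from this[of "i + 1"] show ?thesis
    using True by (simp add: add.commute)
next
  case False
  then have "\<lfloor>real i + a\<rfloor> = int i"
    using assms by (simp add: floor_eq_iff)
  then show ?thesis
    by (simp add: curve_def frac_def)
qed

lemma curve_vertex: "curve P (real i) = vertex P i"
  using curve_segment[of 0 P i] by simp

lemma continuous_on_curve: "continuous_on {1..real n} (curve P)"
proof (induction n)
  case (Suc n)
  show ?case
  proof (cases n)
    case (Suc n')
    have "continuous_on {real n..real n + 1} (curve P)"
    proof (rule continuous_on_eq)
      show "continuous_on {real n..real n + 1}
          (\<lambda>s. (1 - (s - real n)) * vertex P n + (s - real n) * vertex P (n + 1))"
        by (intro continuous_intros)
      show "(1 - (s - real n)) * vertex P n + (s - real n) * vertex P (n + 1) = curve P s"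
        if "s \<in> {real n..real n + 1}" for s
        using curve_segment[of "s - real n" P n] that by simp
    qed
    then have "continuous_on ({1..real n} \<union> {real n..real n + 1}) (curve P)"
      using Suc.IH by (intro continuous_on_closed_Un) auto
    moreover have "{1..real n} \<union> {real n..real n + 1} = {1..real (Suc n)}"
      using Suc by auto
    ultimately show ?thesis
      by simp
  qed simp
qed simp

lemma curve_edge_monotone:
  "mono_on {real i..real i + 1} (curve Q) \<or> antimono_on {real i..real i + 1} (curve Q)"
proof -
  have curve: "curve Q s = vertex Q i + (s - real i) * (vertex Q (i + 1) - vertex Q i)"
    if "s \<in> {real i..real i + 1}" for s
    using curve_segment[of "s - real i" Q i] that by (simp add: algebra_simps)
  show ?thesis
  proof (cases "vertex Q i \<le> vertex Q (i + 1)")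
    case True
    then have "mono_on {real i..real i + 1} (curve Q)"
      by (intro monotone_onI) (simp add: curve mult_right_mono)
    then show ?thesis ..
  next
    case False
    then have "antimono_on {real i..real i + 1} (curve Q)"
      by (intro monotone_onI) (simp add: curve mult_right_mono_neg)
    then show ?thesis ..
  qed
qed

section \<open>The curve after the removal of a vertex\<close>

lemma vertex_remove_vertex_before:
  assumes "1 \<le> k" "k < j" "j \<le> length Q"
  shows "vertex (remove_vertex j Q) k = vertex Q k"
proof -
  have "k - 1 < j - 1"
    using assms by simp
  then show ?thesis
    using assms by (simp add: vertex_def remove_vertex_def nth_append)
qed

text \<open>Beyond the end of the list both sides are the same unspecified access, so
  \<open>curve_remove_vertex_after\<close> covers the final time without a separate case.\<close>

lemma vertex_remove_vertex_after:
  assumes "1 \<le> j" "j \<le> k" "j \<le> length Q"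
  shows "vertex (remove_vertex j Q) k = vertex Q (k + 1)"
proof -
  have "\<not> k - 1 < j - 1" "j + (k - 1 - (j - 1)) = k"
    using assms by simp_all
  then show ?thesis
    using assms by (simp add: vertex_def remove_vertex_def nth_append)
qed

lemma curve_remove_vertex_before:
  assumes "2 \<le> j" "j \<le> length Q" "1 \<le> t" "t \<le> real (j - 1)"
  shows "curve (remove_vertex j Q) t = curve Q t"
proof -
  obtain i :: nat where i: "\<lfloor>t\<rfloor> = int i"
    using assms(3) by (metis zero_le_floor nonneg_int_cases order_trans zero_le_one)
  define a where "a = t - real i"
  have a: "0 \<le> a" "a < 1" "t = real i + a"
    using floor_correct[of t] i by (simp_all add: a_def)
  have "1 \<le> i"
    using assms(3) i by linarith
  have "i < j"
    using assms a by linarith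
  show ?thesis
  proof (cases "i + 1 < j")
    case True
    then show ?thesis
      using a curve_segment[of a _ i] vertex_remove_vertex_before[of _ j Q] assms \<open>1 \<le> i\<close> by simp
  next
    case False
    then have "t = real i"
      using assms a \<open>i < j\<close> by auto
    then show ?thesis
      using curve_vertex vertex_remove_vertex_before[of i j Q] assms \<open>1 \<le> i\<close> \<open>i < j\<close> by simp
  qed
qed

lemma curve_remove_vertex_after:
  assumes "1 \<le> j" "j \<le> length Q" "real j + 1 \<le> t"
  shows "curve (remove_vertex j Q) (t - 1) = curve Q t"
proof -
  obtain i :: nat where i: "\<lfloor>t - 1\<rfloor> = int i"
    using assms(3) by (metis zero_le_floor nonneg_int_cases of_nat_0_le_iff order_trans le_diff_eq)
  define a where "a = t - 1 - real i"
  have a: "0 \<le> a" "a < 1" "t - 1 = real i + a" "t = real (i + 1) + a"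
    using floor_correct[of "t - 1", unfolded i] by (simp_all add: a_def)
  have "j \<le> i"
    using assms(3) i by linarith
  have "curve (remove_vertex j Q) (t - 1) = (1 - a) * vertex Q (i + 1) + a * vertex Q (i + 1 + 1)"
    unfolding a(3) using curve_segment[of a "remove_vertex j Q" i] a(1,2)
      vertex_remove_vertex_after[of j _ Q] assms(1,2) \<open>j \<le> i\<close> by simp
  also have "\<dots> = curve Q t"
    unfolding a(4) using curve_segment[of a Q "i + 1"] a(1,2) by simp
  finally show ?thesis .
qed

lemma curve_remove_vertex_at:
  assumes "2 \<le> j" "j \<le> length Q" "0 \<le> a" "a \<le> 1"
  shows "curve (remove_vertex j Q) (real (j - 1) + a) = (1 - a) * vertex Q (j - 1) + a * vertex Q (j + 1)"
  using curve_segment[of a "remove_vertex j Q" "j - 1"] vertex_remove_vertex_before[of "j - 1" j Q]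
    vertex_remove_vertex_after[of j j Q] assms by simp

lemma length_remove_vertex:
  assumes "1 \<le> j" "j \<le> length Q"
  shows "length (remove_vertex j Q) = length Q - 1"
  using assms by (simp add: remove_vertex_def)

section \<open>The Frechet distance in terms of matchings\<close>

lemma reparametrization_iff: "reparametrization n h \<longleftrightarrow> monotone_path 1 (real n) h"
  using monotone_path_bounds[of 1 "real n" h]
  by (auto simp: reparametrization_def monotone_path_def)

text \<open>A real \<open>SUP\<close> bounds its members only if the family is bounded, which
  compactness of \<open>[0, 1]\<close> guarantees.\<close>

lemma bdd_above_curve_difference:
  assumes "reparametrization (length P) h" "reparametrization (length Q) g"
  shows "bdd_above ((\<lambda>a. \<bar>curve P (h a) - curve Q (g a)\<bar>) ` {0..1})"
proof -
  have "continuous_on {0..1} (\<lambda>a. \<bar>curve P (h a) - curve Q (g a)\<bar>)"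
    using assms unfolding reparametrization_def
    by (intro continuous_intros continuous_on_compose2[OF continuous_on_curve[of "length P"]]
        continuous_on_compose2[OF continuous_on_curve[of "length Q"]]) auto
  then have "compact ((\<lambda>a. \<bar>curve P (h a) - curve Q (g a)\<bar>) ` {0..1})"
    by (rule compact_continuous_image) simp
  then show ?thesis
    by (intro bounded_imp_bdd_above compact_imp_bounded)
qed

text \<open>Strictness matters: an infimum below \<open>D\<close> has a member below
  \<open>D\<close>, whereas equality would call for attainment.\<close>

lemma frechet_dist_less_imp_frechet_le:
  assumes "P \<noteq> []" "Q \<noteq> []" "frechet_dist P Q < D"
  shows "frechet_le D (curve P) 1 (length P) (curve Q) 1 (length Q)"
proof -
  let ?S = "{(SUP a\<in>{0..1}. \<bar>curve P (h a) - curve Q (g a)\<bar>) | h g.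
            reparametrization (length P) h \<and> reparametrization (length Q) g}"
  \<comment> \<open>The linear reparametrizations witness that the infimum is over a nonempty set,
    as \<open>cInf_lessD\<close> requires.\<close>
  have lin: "reparametrization n (\<lambda>t. 1 + (real n - 1) * t)" if "1 \<le> n" for n
    unfolding reparametrization_iff monotone_path_def
    using that by (auto intro!: continuous_intros mono_onI mult_left_mono)
  have "reparametrization (length P) (\<lambda>t. 1 + (real (length P) - 1) * t)"
    "reparametrization (length Q) (\<lambda>t. 1 + (real (length Q) - 1) * t)"
    using assms(1,2) by (auto intro!: lin simp: Suc_le_eq)
  then have "?S \<noteq> {}"
    by blast
  then obtain y where "y \<in> ?S" "y < D"
    using cInf_lessD[of ?S D] assms(3) unfolding frechet_dist_def by blast
  then obtain h g where hg: "reparametrization (length P) h" "reparametrization (length Q) g"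
      and less: "(SUP a\<in>{0..1}. \<bar>curve P (h a) - curve Q (g a)\<bar>) < D"
    by auto
  have "\<bar>curve P (h a) - curve Q (g a)\<bar> \<le> D" if "a \<in> {0..1}" for a
    using cSUP_upper[OF that bdd_above_curve_difference[OF hg]] less by linarith
  then show ?thesis
    using hg unfolding reparametrization_iff frechet_le_def by blast
qed

lemma frechet_le_imp_frechet_dist_le:
  assumes "frechet_le D (curve P) 1 (length P) (curve Q) 1 (length Q)"
  shows "frechet_dist P Q \<le> D"
proof -
  let ?f = "\<lambda>h g. (SUP a\<in>{0..1}. \<bar>curve P (h a) - curve Q (g a)\<bar>)"
  let ?S = "{?f h g | h g. reparametrization (length P) h \<and> reparametrization (length Q) g}"
  obtain h g where hg: "monotone_path 1 (length P) h" "monotone_path 1 (length Q) g"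
      "\<forall>t\<in>{0..1}. \<bar>curve P (h t) - curve Q (g t)\<bar> \<le> D"
    using assms by (rule frechet_leE)
  have "0 \<le> ?f h g" if "reparametrization (length P) h" "reparametrization (length Q) g" for h g
    using cSUP_upper[OF _ bdd_above_curve_difference[OF that], of 0] by force
  then have "bdd_below ?S"
    by (intro bdd_belowI[of _ 0]) auto
  moreover have "?f h g \<in> ?S"
    using hg(1,2) unfolding reparametrization_iff by blast
  ultimately have "frechet_dist P Q \<le> ?f h g"
    unfolding frechet_dist_def by (rule cInf_lower[rotated])
  also have "\<dots> \<le> D"
    using hg(3) by (intro cSUP_least) auto
  finally show ?thesis .
qed

text \<open>Knot \<open>k\<close> is signature vertex \<open>k + 1\<close>. The weak bounds survive
  the passage from \<open>\<delta>\<close> to a larger \<open>D\<close>; the strict lower bounds on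
  the edge lengths need not, and are therefore assumed for \<open>D\<close>.\<close>

lemma is_signature_imp_function_signature:
  assumes sig: "is_signature \<delta> P i P'" and t: "t = length P'" "2 \<le> t" and D: "0 \<le> \<delta>" "\<delta> \<le> D"
    and long1: "\<And>k. k < t - 1 \<Longrightarrow> 2 < t \<Longrightarrow> D < \<bar>vertex P (i (Suc k)) - vertex P (i (Suc (Suc k)))\<bar>"
    and long2: "\<And>k. 0 < k \<Longrightarrow> Suc k < t - 1 \<Longrightarrow>
      2 * D < \<bar>vertex P (i (Suc k)) - vertex P (i (Suc (Suc k)))\<bar>"
  shows "function_signature D (curve P) (\<lambda>k. real (i (Suc k))) (t - 1)"
proof -
  have ends: "i 1 = 1" "i t = length P" and i_mono: "strict_mono_on {1..t} i"
    and turn: "\<And>k. k \<in> {2..t - 1} \<Longrightarrow>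
      vertex P (i k) \<notin> closed_segment (vertex P (i (k - 1))) (vertex P (i (k + 1)))"
    and mono: "\<And>k. k \<in> {1..t - 1} \<Longrightarrow>
         eps_mono_increasing (2 * \<delta>) (curve P) {real (i k)..real (i (k + 1))} \<or>
         eps_mono_decreasing (2 * \<delta>) (curve P) {real (i k)..real (i (k + 1))}"
    and middle: "\<And>k s. k \<in> {2..t - 2} \<Longrightarrow> s \<in> {real (i k)..real (i (k + 1))} \<Longrightarrow>
         curve P s \<in> closed_segment (vertex P (i k)) (vertex P (i (k + 1)))"
    and first: "\<And>s. 2 < t \<Longrightarrow> s \<in> {1..real (i 2)} \<Longrightarrow>
            curve P s \<in> cball (vertex P 1) \<delta> \<union> closed_segment (vertex P 1) (vertex P (i 2))"
    and last: "\<And>s. 2 < t \<Longrightarrow> s \<in> {real (i (t - 1))..real (length P)} \<Longrightarrow>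
            curve P s \<in> cball (vertex P (length P)) \<delta> \<union>
              closed_segment (vertex P (i (t - 1))) (vertex P (length P))"
    and single: "\<And>s. t = 2 \<Longrightarrow> s \<in> {1..real (length P)} \<Longrightarrow>
            curve P s \<in> nbhd (closed_segment (vertex P 1) (vertex P (length P))) \<delta>"
    using sig unfolding is_signature_def Let_def t(1)[symmetric] by blast+
  have segment: "v \<in> closed_segment a b \<longleftrightarrow> min a b \<le> v \<and> v \<le> max a b" for v a b :: real
    by (auto simp: closed_segment_eq_real_ivl)
  show ?thesis
    unfolding function_signature_def curve_vertex
  proof (intro conjI allI impI)
    show "0 < t - 1"
      using t by simp
    show "real (i (Suc k)) < real (i (Suc (Suc k)))" if "k < t - 1" for k
      using strict_mono_onD[OF i_mono, of "Suc k" "Suc (Suc k)"] that by auto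
    show "(\<forall>s s'. real (i (Suc k)) \<le> s \<longrightarrow> s \<le> s' \<longrightarrow> s' \<le> real (i (Suc (Suc k))) \<longrightarrow>
             curve P s \<le> curve P s' + 2 * D) \<or>
          (\<forall>s s'. real (i (Suc k)) \<le> s \<longrightarrow> s \<le> s' \<longrightarrow> s' \<le> real (i (Suc (Suc k))) \<longrightarrow>
             curve P s' \<le> curve P s + 2 * D)" (is "?inc \<or> ?dec") if k: "k < t - 1" for k
    proof -
      have "Suc k \<in> {1..t - 1}"
        using k by auto
      from mono[OF this] show ?thesis
      proof
        assume inc: "eps_mono_increasing (2 * \<delta>) (curve P) {real (i (Suc k))..real (i (Suc k + 1))}"
        have ?inc
        proof (intro allI impI)
          fix s s'
          assume "real (i (Suc k)) \<le> s" "s \<le> s'" "s' \<le> real (i (Suc (Suc k)))"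
          then show "curve P s \<le> curve P s' + 2 * D"
            using inc[unfolded eps_mono_increasing_def, rule_format, of s s'] D by (cases "s = s'") auto
        qed
        then show ?thesis ..
      next
        assume dec: "eps_mono_decreasing (2 * \<delta>) (curve P) {real (i (Suc k))..real (i (Suc k + 1))}"
        have ?dec
        proof (intro allI impI)
          fix s s'
          assume "real (i (Suc k)) \<le> s" "s \<le> s'" "s' \<le> real (i (Suc (Suc k)))"
          then show "curve P s' \<le> curve P s + 2 * D"
            using dec[unfolded eps_mono_decreasing_def, rule_format, of s s'] D by (cases "s = s'") auto
        qed
        then show ?thesis ..
      qed
    qed
    show "vertex P (i (Suc (Suc k))) < min (vertex P (i (Suc k))) (vertex P (i (Suc (Suc (Suc k))))) \<or>
        max (vertex P (i (Suc k))) (vertex P (i (Suc (Suc (Suc k))))) < vertex P (i (Suc (Suc k)))"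
      if "Suc k < t - 1" for k
      using turn[of "Suc (Suc k)"] that by (auto simp: segment)
    show "D < \<bar>vertex P (i (Suc k)) - vertex P (i (Suc (Suc k)))\<bar>" if "k < t - 1" "1 < t - 1" for k
      using that by (intro long1) auto
    show "2 * D < \<bar>vertex P (i (Suc k)) - vertex P (i (Suc (Suc k)))\<bar>" if "0 < k \<and> Suc k < t - 1" for k
      using that by (intro long2) auto
    show "(min (vertex P (i (Suc k))) (vertex P (i (Suc (Suc k)))) \<le> curve P s \<and>
           curve P s \<le> max (vertex P (i (Suc k))) (vertex P (i (Suc (Suc k))))) \<or>
         (k = 0 \<and> \<bar>curve P s - vertex P (i (Suc 0))\<bar> \<le> D) \<or>
         (Suc k = t - 1 \<and> \<bar>curve P s - vertex P (i (Suc (t - 1)))\<bar> \<le> D)"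
      if k: "k < t - 1" and s: "real (i (Suc k)) \<le> s" "s \<le> real (i (Suc (Suc k)))" for k s
    proof -
      have [simp]: "Suc (t - 1) = t"
        using t by simp
      consider "t = 2" | "2 < t" "k = 0" | "2 < t" "Suc k = t - 1" | "Suc k \<in> {2..t - 2}"
        using k t(2) by force
      then show ?thesis
      proof cases
        case 1
        then have "k = 0" "Suc (Suc k) = t"
          using k by auto
        then have "curve P s \<in> nbhd (closed_segment (vertex P (i 1)) (vertex P (i t))) \<delta>"
          using single[of s] 1 s ends by (auto simp: numeral_2_eq_2)
        \<comment> \<open>A value within \<open>\<delta>\<close> of the only segment lies on it or
          within \<open>\<delta>\<close> of one of its ends, and for a single edge both exceptions
          are open.\<close>
        then obtain v where "min (vertex P (i 1)) (vertex P (i t)) \<le> v"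
            "v \<le> max (vertex P (i 1)) (vertex P (i t))" "\<bar>v - curve P s\<bar> \<le> \<delta>"
          by (auto simp: nbhd_def segment dist_real_def)
        then show ?thesis
          using \<open>k = 0\<close> \<open>Suc (Suc k) = t\<close> D by (auto simp: min_def max_def split: if_splits)
      next
        case 2
        then have "curve P s \<in> cball (vertex P (i 1)) \<delta> \<union> closed_segment (vertex P (i 1)) (vertex P (i 2))"
          using first[of s] s ends by (auto simp: numeral_2_eq_2)
        then show ?thesis
          using 2 D by (auto simp: segment dist_real_def numeral_2_eq_2)
      next
        case 3
        then have "t - 1 = Suc k" "t = Suc (Suc k)"
          by auto
        then have "curve P s \<in> cball (vertex P (i t)) \<delta> \<union> closed_segment (vertex P (i (Suc k))) (vertex P (i t))"
          using last[of s] s ends \<open>2 < t\<close> by auto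
        then show ?thesis
          using \<open>t = Suc (Suc k)\<close> D by (auto simp: segment dist_real_def)
      next
        case 4
        then show ?thesis
          using middle[OF 4, of s] s by (auto simp: segment)
      qed
    qed
  qed
qed

section \<open>Choice of \<open>D\<close> and removal of the vertex\<close>

lemma eventually_at_right_lessI:
  fixes a b :: real
  assumes "a < b"
  shows "eventually (\<lambda>D. D < b) (at_right a)"
  using eventually_at_right_real[OF assms] by eventually_elim simp

theorem corollary11:
  fixes \<delta> :: real and P P' Q Q' :: "real list"
    and i :: "nat \<Rightarrow> nat" and r :: "nat \<Rightarrow> real set" and s\<^sub>P j :: nat
  assumes "\<delta> \<ge> 0"
    and "P \<noteq> []"
    and "is_signature \<delta> P i P'"
    and "s\<^sub>P = length P'"
    and "r 1 = cball (vertex P (i 1)) (3 * \<delta>)"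
    and "r s\<^sub>P = cball (vertex P (i s\<^sub>P)) (3 * \<delta>)"
    and "\<forall>k\<in>{2..s\<^sub>P - 1}. r k = cball (vertex P (i k)) \<delta>"
    and "Q \<noteq> []"
    and "Q' \<noteq> []"
    and "frechet_dist P Q \<le> \<delta>"
    and "j \<in> {1..length Q}"
    and "Q' = remove_vertex j Q"
    and "vertex Q j \<notin> (\<Union>k\<in>{1..s\<^sub>P}. r k)"
  shows "frechet_dist P Q' \<le> \<delta>"
proof (rule ccontr)
  assume contra: "\<not> frechet_dist P Q' \<le> \<delta>"
  define t where "t = length P'"
  define w where "w = vertex Q j"
  note sig = assms(3)
  have t1: "1 \<le> t" and ends: "i 1 = 1" "i t = length P"
    and i_mono: "strict_mono_on {1..t} i"
    using sig unfolding is_signature_def Let_def t_def[symmetric] by blast+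
  have long2: "2 * \<delta> < \<bar>vertex P (i (Suc k)) - vertex P (i (Suc (Suc k)))\<bar>"
    if "0 < k" "Suc k < t - 1" for k
  proof -
    have "2 < t" "Suc k \<in> {2..t - 2}"
      using that by auto
    then have "2 * \<delta> < \<bar>vertex P (i (Suc k)) - vertex P (i (Suc k + 1))\<bar>"
      using sig unfolding is_signature_def Let_def t_def[symmetric] by blast
    then show ?thesis
      by simp
  qed
  have long1: "\<delta> < \<bar>vertex P (i (Suc k)) - vertex P (i (Suc (Suc k)))\<bar>"
    if k: "k < t - 1" "2 < t" for k
  proof -
    have e: "\<delta> < \<bar>vertex P (i 1) - vertex P (i 2)\<bar>" "\<delta> < \<bar>vertex P (i (t - 1)) - vertex P (i t)\<bar>"
      using sig k(2) unfolding is_signature_def Let_def t_def[symmetric] by blast+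
    consider "k = 0" | "t = Suc (Suc k)" | "0 < k" "Suc k < t - 1"
      using k by linarith
    then show ?thesis
    proof cases
      case 3
      then show ?thesis
        using long2[of k] assms(1) by simp
    qed (use e in \<open>auto simp: numeral_2_eq_2\<close>)
  qed
  have r: "w \<notin> r k" if "1 \<le> k" "k \<le> t" for k
    using assms(13) that by (auto simp: assms(4) t_def w_def)
  have far1: "3 * \<delta> < \<bar>w - vertex P (i 1)\<bar>" "3 * \<delta> < \<bar>w - vertex P (i t)\<bar>"
    using r[of 1] r[of t] t1 assms(5,6) by (auto simp: assms(4) t_def[symmetric] dist_real_def)
  have far: "\<delta> < \<bar>w - vertex P (i (Suc k))\<bar>" if "0 < k" "k < t - 1" for k
  proof -
    have "Suc k \<in> {2..t - 1}" "Suc k \<le> t"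
      using that by auto
    then have "r (Suc k) = cball (vertex P (i (Suc k))) \<delta>" "w \<notin> r (Suc k)"
      using assms(7) r[of "Suc k"] by (auto simp: assms(4) t_def)
    then show ?thesis
      by (auto simp: dist_real_def)
  qed
  \<comment> \<open>Finitely many strict inequalities that hold at \<open>\<delta>\<close> and hence
    for all \<open>D\<close> slightly above it. The bound by \<open>frechet_dist P Q'\<close> makes
    any matching of width \<open>D\<close> with \<open>Q'\<close> a contradiction.\<close>
  define good where "good D \<longleftrightarrow> \<delta> < D \<and> D < frechet_dist P Q' \<and>
      3 * D < \<bar>w - vertex P (i 1)\<bar> \<and> 3 * D < \<bar>w - vertex P (i t)\<bar> \<and>
      (\<forall>k\<in>{k. 0 < k \<and> k < t - 1}. D < \<bar>w - vertex P (i (Suc k))\<bar>) \<and>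
      (\<forall>k\<in>{k. k < t - 1 \<and> 2 < t}. D < \<bar>vertex P (i (Suc k)) - vertex P (i (Suc (Suc k)))\<bar>) \<and>
      (\<forall>k\<in>{k. 0 < k \<and> Suc k < t - 1}.
         2 * D < \<bar>vertex P (i (Suc k)) - vertex P (i (Suc (Suc k)))\<bar>)" for D
  have "\<forall>\<^sub>F D in at_right \<delta>. good D"
    unfolding good_def
  proof (intro eventually_conj eventually_ball_finite ballI)
    have scaled: "\<forall>\<^sub>F D in at_right \<delta>. c * D < b" if "c * \<delta> < b" "0 < c" for b c :: real
      using eventually_at_right_lessI[of \<delta> "b / c"] that by (simp add: field_simps)
    show "finite {k. 0 < k \<and> Suc k < t - 1}"
      by (rule finite_subset[of _ "{..<t}"]) auto
    show "\<forall>\<^sub>F D in at_right \<delta>. 3 * D < \<bar>w - vertex P (i 1)\<bar>"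
      "\<forall>\<^sub>F D in at_right \<delta>. 3 * D < \<bar>w - vertex P (i t)\<bar>"
      using far1 by (intro scaled; simp)+
    show "\<forall>\<^sub>F D in at_right \<delta>. 2 * D < \<bar>vertex P (i (Suc k)) - vertex P (i (Suc (Suc k)))\<bar>"
      if "k \<in> {k. 0 < k \<and> Suc k < t - 1}" for k
      using long2 that by (intro scaled) auto
  qed (use contra far long1 in \<open>auto intro: eventually_at_right_lessI simp: eventually_at_right_less\<close>)
  then obtain D where "good D"
    using eventually_happens'[OF trivial_limit_at_right_real] by blast
  then have D: "\<delta> < D" "D < frechet_dist P Q'"
    "3 * D < \<bar>w - vertex P (i 1)\<bar>" "3 * D < \<bar>w - vertex P (i t)\<bar>"
    and farD: "\<And>k. 0 < k \<Longrightarrow> k < t - 1 \<Longrightarrow> D < \<bar>w - vertex P (i (Suc k))\<bar>"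
    and long1D: "\<And>k. k < t - 1 \<Longrightarrow> 2 < t \<Longrightarrow>
      D < \<bar>vertex P (i (Suc k)) - vertex P (i (Suc (Suc k)))\<bar>"
    and long2D: "\<And>k. 0 < k \<Longrightarrow> Suc k < t - 1 \<Longrightarrow>
      2 * D < \<bar>vertex P (i (Suc k)) - vertex P (i (Suc (Suc k)))\<bar>"
    by (auto simp: good_def)
  \<comment> \<open>True even for \<open>\<delta> = 0\<close>; the recursion draws its positive time
    step from it.\<close>
  have "0 < D"
    using D assms(1) by simp
  have j: "1 \<le> j" "j \<le> length Q"
    using assms(11) by auto
  have match: "frechet_le D (curve P) 1 (length P) (curve Q) 1 (length Q)"
    using assms(2,8,10) D(1) by (intro frechet_dist_less_imp_frechet_le) auto
  have start: "\<bar>vertex P (i 1) - vertex Q 1\<bar> \<le> D"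
    using frechet_le_start[OF match] curve_vertex[of _ 1] ends by simp
  have finish: "\<bar>vertex P (i t) - vertex Q (length Q)\<bar> \<le> D"
    using frechet_le_end[OF match] curve_vertex ends by simp
  \<comment> \<open>The end vertices of \<open>Q\<close> are within \<open>D\<close> of those of
    \<open>P\<close>, but \<open>w\<close> is more than \<open>3 * D\<close> away from the latter.
    So the removed vertex has two neighbours.\<close>
  have j_inner: "2 \<le> j" "j < length Q"
  proof -
    have "j \<noteq> 1"
      using start D(3) \<open>0 < D\<close> by (auto simp: w_def)
    then show "2 \<le> j"
      using j by simp
    have "j \<noteq> length Q"
      using finish D(4) \<open>0 < D\<close> by (auto simp: w_def)
    then show "j < length Q"
      using j by simp
  qed
  \<comment> \<open>With a single signature vertex \<open>P\<close> is one point, by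
    \<open>i 1 = 1\<close> and \<open>i t = length P\<close>, and the whole of \<open>Q\<close>
    would be within \<open>D\<close> of it.\<close>
  have "t \<noteq> 1"
  proof
    assume "t = 1"
    obtain s where "1 \<le> s" "s \<le> real (length P)" "\<bar>curve P s - curve Q (real j)\<bar> \<le> D"
      by (rule frechet_le_matched_right[OF match, of "real j"]) (use j in auto)
    moreover have "real (length P) = 1"
      using \<open>t = 1\<close> ends by simp
    ultimately show False
      using D(3) \<open>0 < D\<close> curve_vertex[of _ 1] curve_vertex[of _ j] ends by (auto simp: w_def)
  qed
  then have t2: "2 \<le> t"
    using t1 by simp
  define x where "x = (\<lambda>k. real (i (Suc k)))"
  have fsig: "function_signature D (curve P) x (t - 1)"
    unfolding x_def by (rule is_signature_imp_function_signature[OF sig t_def t2])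
      (use D long1D long2D assms(1) in auto)
  have favoid: "avoids_signature D (curve P) x (t - 1) (curve Q (real j))"
    using D farD t2 by (auto simp: avoids_signature_def curve_vertex w_def x_def)
  have x_ends: "x 0 = 1" "x (t - 1) = real (length P)"
    using ends t2 by (simp_all add: x_def)
  have rj: "real (j - Suc 0) = real j - 1"
    using j by simp
  \<comment> \<open>The two unit edges meeting at \<open>j\<close> become the single unit edge from
    \<open>j - 1\<close> to \<open>j\<close>. Hence \<open>\<beta>\<close> is \<open>j + 1\<close>,
    \<open>\<beta>'\<close> is \<open>j\<close>, and all later times move back by one.\<close>
  have "frechet_le D (curve P) (x 0) (x (t - 1)) (curve Q') 1 (real (length Q) + (real j - (real j + 1)))"
  proof (rule frechet_le_remove_between[where Q = "curve Q" and \<sigma> = "real j"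
        and \<alpha> = "real (j - 1)" and \<beta> = "real j + 1" and \<beta>' = "real j"])
    show "continuous_on {x 0..x (t - 1)} (curve P)" "continuous_on {1..real (length Q)} (curve Q)"
      unfolding x_ends by (rule continuous_on_curve)+
    show "frechet_le D (curve P) (x 0) (x (t - 1)) (curve Q) 1 (real (length Q))"
      unfolding x_ends by (rule match)
    show "mono_on {real (j - 1)..real j} (curve Q) \<or> antimono_on {real (j - 1)..real j} (curve Q)"
      using curve_edge_monotone[of "j - 1" Q] by (simp add: rj)
    show "mono_on {real j..real j + 1} (curve Q) \<or> antimono_on {real j..real j + 1} (curve Q)"
      by (rule curve_edge_monotone)
    show "curve Q' s = curve Q s" if "1 \<le> s" "s \<le> real (j - 1)" for s
      using curve_remove_vertex_before[of j Q s] j_inner that by (simp add: assms(12))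
    show "curve Q' (real (j - 1) + a * (real j - real (j - 1))) =
        (1 - a) * curve Q (real (j - 1)) + a * curve Q (real j + 1)" if "0 \<le> a" "a \<le> 1" for a
      using curve_remove_vertex_at[of j Q a] curve_vertex[of Q "j - 1"] curve_vertex[of Q "j + 1"] j_inner that
      by (simp add: assms(12) rj add.commute)
    show "curve Q' (s + (real j - (real j + 1))) = curve Q s" if "real j + 1 \<le> s" "s \<le> real (length Q)" for s
      using curve_remove_vertex_after[of j Q s] j that by (simp add: assms(12))
  qed (use \<open>0 < D\<close> fsig favoid j_inner in auto)
  then have "frechet_le D (curve P) 1 (length P) (curve Q') 1 (length Q')"
    using length_remove_vertex[OF j] j unfolding x_ends by (simp add: assms(12))
  then show False
    using frechet_le_imp_frechet_dist_le D(2) by force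
qed

end
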